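(* Fix $a\in(1/2,1)$, let $h(x)=\max\{1-|x-1|,0\}$, $g=(0,h)^T$, and for $t=(t_k)_{k\ge1}\in[0,1]^{\mathbb N}$ let $$A_0^{[k]}=\begin{pmatrix}a&0\\0&1/2\end{pmatrix},\quad A_1^{[k]}=\begin{pmatrix}0&0\\0&1\end{pmatrix},\quad A_2^{[k]}=\begin{pmatrix}0&t_k\\0&1/2\end{pmatrix},\qquad (V_kf)(x)=\sum_{j=0}^2A_j^{[k]}f(2x-j).$$ Then: (i) For every $t\in[0,1]^{\mathbb N}$ and every $n\ge1$, with $$\Phi_t=(\phi_t,h)^T,\qquad \phi_t(x)=\sum_{k\ge1}a^{k-1}t_k\,h(2^kx-2),$$ one has $\|V_1\cdots V_ng-\Phi_t\|_\infty\le a^n$; moreover, for the constant matching map $P_k=P=(0,1,0,1)$, the defects satisfy $\delta_k=0$ for all $k$ and the chronological radius is $\rho_{\rm ch}=a$. (ii) Let $\mathcal C_a=\{\phi_t:t\in[0,1]^{\mathbb N}\}$. For all $t,s\in[0,1]^{\mathbb N}$, $$\|\phi_t-\phi_s\|_\infty=\sup_{k\ge1}a^{k-1}|t_k-s_k|,$$ and $$H_\varepsilon(\mathcal C_a)=\frac{(\log_2\varepsilon^{-1})^2}{2\log_2a^{-1}}+O_a(\log\varepsilon^{-1}),\qquad \varepsilon\downarrow0.$$ The vector class $\{\Phi_t:t\in[0,1]^{\mathbb N}\}$ has the same entropy. (iii) If $a\in\mathbb Q$, then for small $\varepsilon>0$ there is a deterministic fixed-length code for $\mathcal C_a$ with worst-case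 distortion at most $\varepsilon$, whose reconstructions are functions $\phi_{\hat t}$ with $\hat t$ having finitely many nonzero coordinates, all dyadic rationals, with bit length $$B_\varepsilon\le\frac{(\log_2\varepsilon^{-1})^2}{2\log_2a^{-1}}+O_a(\log\varepsilon^{-1}),$$ and such that every reconstruction is computed exactly on $\mathbb R$ by a ReLU network with rational parameters, of width $O(1)$ and with depth and number of parameters $O_a(\log\varepsilon^{-1})$. The leading coefficient $1/(2\log_2a^{-1})$ of $(\log_2\varepsilon^{-1})^2$ is optimal among all deterministic fixed-length codes of worst-case distortion $\varepsilon$.
   Context: Conventions. $\|f\|_\infty=\sup_{x\in\mathbb R}\max_i|f_i(x)|$. In $V_1\cdots V_ng$ the rightmost operator acts first. A ReLU network consists of affine maps separated by coordinatewise activations $t\mapsto\max\{t,0\}$ with an affine output layer; width is the largest hidden dimension, depth the number of hidden layers, and the parameter count includes all affine entries. Matching and radius. Use the window $[\ell_-,\ell_+]=[0,2]$, so the block state is $G_f(x)=(f(x),f(x+1))^T\in\mathbb R^4$ for $x\in[0,1]$. For $\epsilon\in\{0,1\}$, $T^{[k]}_\epsilon\in\mathbb R^{4\times4}$ has $2\times2$ blocks $[T^{[k]}_\epsilon]_{i\ell}=A^{[k]}_{2i-\ell-1+\epsilon}$, $i,\ell\in\{1,2\}$ (with $A_j^{[k]}=0$ for $j\notin\{0,1,2\}$). For matching maps $P_k$ (full row rank), $U_k$ has columns forming an orthonormal basis of $\ker P_k$, $S_k=[\,U_k\ \ P_k^\dagger\,]$ with $P_k^\dagger$ the pseudoinverse,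 and $C_{k,\epsilon}=U_k^TT_\epsilon^{[k]}U_{k+1}$. The chronological radius is $\rho_{\rm ch}=\lim_{m\to\infty}\chi_m^{1/m}$ with $\chi_m=\sup_{b\ge1}\max_{\epsilon_b,\dots,\epsilon_{b+m-1}\in\{0,1\}}\|C_{b,\epsilon_b}\cdots C_{b+m-1,\epsilon_{b+m-1}}\|$. The defect is $\delta_k=\max_\epsilon\|(P_kT^{[k]}_\epsilon-P_{k+1})S_{k+1}\|_2+\sup_{x\in[0,1]}\|P_kG_{V_kg-g}(x)\|_2$. Entropy and codes. For a compact function class $\mathcal C$, $N(\varepsilon,\mathcal C)$ is the minimal number of closed uniform-norm balls of radius $\varepsilon$, with arbitrary bounded functions as centers, covering $\mathcal C$, and $H_\varepsilon(\mathcal C)=\log_2N(\varepsilon,\mathcal C)$. A deterministic fixed-length code of bit length $B$ is a pair of maps: an encoder $E:\mathcal C\to\{0,1\}^B$ and a decoder $R$ from $\{0,1\}^B$ to bounded functions; its worst-case distortion is $\sup_{f\in\mathcal C}\|f-R(E(f))\|_\infty$. The decoder, $a$ and $\varepsilon$ are shared and not counted in $B$. $O_a$ denotes constants depending only on $a$. *)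

theory Defs
  imports "HOL-Analysis.Analysis"
begin

subsection \<open>Uniform norm and subdivision operators\<close>

text \<open>The supremum is taken in the extended reals, so that a bound on it is meaningful
  for every function; \<^const>\<open>infnorm\<close> is the maximum of the absolute values of the coordinates
  (and the absolute value on the reals).\<close>

definition sup_norm :: "(real \<Rightarrow> 'a::euclidean_space) \<Rightarrow> ereal" where
  "sup_norm f = (SUP x. ereal (infnorm (f x)))"

definition hat :: "real \<Rightarrow> real" where
  "hat x = max (1 - \<bar>x - 1\<bar>) 0"

definition gen :: "real \<Rightarrow> real^2" where
  "gen x = vector [0, hat x]"

definition subdiv_mask :: "real \<Rightarrow> real \<Rightarrow> int \<Rightarrow> real^2^2" where
  "subdiv_mask a \<tau> j =
    (if j = 0 then vector [vector [a, 0], vector [0, 1/2]]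
     else if j = 1 then vector [vector [0, 0], vector [0, 1]]
     else if j = 2 then vector [vector [0, \<tau>], vector [0, 1/2]]
     else 0)"

definition subdiv :: "(int \<Rightarrow> real^2^2) \<Rightarrow> (real \<Rightarrow> real^2) \<Rightarrow> real \<Rightarrow> real^2" where
  "subdiv A f x = (\<Sum>j\<in>{0..2}. A j *v f (2 * x - of_int j))"

text \<open>\<open>cascade V n g\<close> is \<open>V\<^sub>1 (V\<^sub>2 (\<dots> (V\<^sub>n g)))\<close>.\<close>

definition cascade :: "(nat \<Rightarrow> 'f \<Rightarrow> 'f) \<Rightarrow> nat \<Rightarrow> 'f \<Rightarrow> 'f" where
  "cascade V n g = foldr V [1..<Suc n] g"

text \<open>Sequences are indexed by \<open>k \<ge> 1\<close>; the value at \<open>0\<close> is never used.\<close>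

definition unit_seqs :: "(nat \<Rightarrow> real) set" where
  "unit_seqs = {t. \<forall>k\<ge>1. t k \<in> {0..1}}"

text \<open>The summation index is \<open>k - 1\<close>.\<close>

definition phi :: "real \<Rightarrow> (nat \<Rightarrow> real) \<Rightarrow> real \<Rightarrow> real" where
  "phi a t x = (\<Sum>k. a ^ k * t (Suc k) * hat (2 ^ Suc k * x - 2))"

definition Phi :: "real \<Rightarrow> (nat \<Rightarrow> real) \<Rightarrow> real \<Rightarrow> real^2" where
  "Phi a t x = vector [phi a t x, hat x]"


subsection \<open>Matching, defect and chronological radius\<close>

definition block_state :: "(real \<Rightarrow> real^2) \<Rightarrow> real \<Rightarrow> real^4" where
  "block_state f x = vector [f x $ 1, f x $ 2, f (x + 1) $ 1, f (x + 1) $ 2]"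

text \<open>Coordinate \<open>r\<close> of a vector in \<open>\<real>\<^sup>4\<close> is coordinate \<open>inner_idx r\<close> of the \<open>block_idx r\<close>-th block
  of length 2.\<close>

definition block_idx :: "4 \<Rightarrow> int" where
  "block_idx r = (if r = 1 \<or> r = 2 then 1 else 2)"

definition inner_idx :: "4 \<Rightarrow> 2" where
  "inner_idx r = (if r = 1 \<or> r = 3 then 1 else 2)"

definition block_matrix :: "(int \<Rightarrow> real^2^2) \<Rightarrow> int \<Rightarrow> real^4^4" where
  "block_matrix A \<epsilon> =
    (\<chi> r c. A (2 * block_idx r - block_idx c - 1 + \<epsilon>) $ inner_idx r $ inner_idx c)"

definition op_norm :: "real^'n^'m \<Rightarrow> real" where
  "op_norm M = onorm ((*v) M)"

text \<open>Moore--Penrose pseudoinverse, by the four Penrose equations.\<close>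

definition pinv :: "real^'n^'m \<Rightarrow> real^'m^'n" where
  "pinv M = (THE X. M ** X ** M = M \<and> X ** M ** X = X \<and>
                    transpose (M ** X) = M ** X \<and> transpose (X ** M) = X ** M)"

definition orthonormal_kernel_basis :: "real^'n^'r \<Rightarrow> real^'d^'n \<Rightarrow> bool" where
  "orthonormal_kernel_basis P U \<longleftrightarrow>
     transpose U ** U = mat 1 \<and> span (columns U) = {v. P *v v = 0}"

definition hcat :: "real^'d^'n \<Rightarrow> real^'r^'n \<Rightarrow> real^('d + 'r)^'n" where
  "hcat U Q = (\<chi> i j. case j of Inl c \<Rightarrow> U $ i $ c | Inr c \<Rightarrow> Q $ i $ c)"

definition defect ::
  "(nat \<Rightarrow> real^4^'r) \<Rightarrow> (nat \<Rightarrow> real^'d^4) \<Rightarrow> (nat \<Rightarrow> int \<Rightarrow> real^2^2) \<Rightarrow>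
   (real \<Rightarrow> real^2) \<Rightarrow> nat \<Rightarrow> ereal" where
  "defect P U A g k =
     ereal (MAX \<epsilon>\<in>{0, 1}. op_norm ((P k ** block_matrix (A k) \<epsilon> - P (Suc k)) **
                                    hcat (U (Suc k)) (pinv (P (Suc k))))) +
     (SUP x\<in>{0..1}. ereal (norm (P k *v block_state (\<lambda>y. subdiv (A k) g y - g y) x)))"

definition kernel_block ::
  "(nat \<Rightarrow> real^'d^4) \<Rightarrow> (nat \<Rightarrow> int \<Rightarrow> real^2^2) \<Rightarrow> nat \<Rightarrow> int \<Rightarrow> real^'d^'d" where
  "kernel_block U A k \<epsilon> = transpose (U k) ** block_matrix (A k) \<epsilon> ** U (Suc k)"

primrec chron_prod :: "(nat \<Rightarrow> int \<Rightarrow> real^'d^'d) \<Rightarrow> nat \<Rightarrow> int list \<Rightarrow> real^'d^'d" where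
  "chron_prod C b [] = mat 1"
| "chron_prod C b (\<epsilon> # w) = C b \<epsilon> ** chron_prod C (Suc b) w"

definition chron_max :: "(nat \<Rightarrow> int \<Rightarrow> real^'d^'d) \<Rightarrow> nat \<Rightarrow> nat \<Rightarrow> real" where
  "chron_max C m b = (MAX w\<in>{w. set w \<subseteq> {0, 1} \<and> length w = m}. op_norm (chron_prod C b w))"

text \<open>The first conjunct says that the suprema \<open>\<chi>\<^sub>m\<close>, taken in the reals, are finite.\<close>

definition has_chron_radius :: "(nat \<Rightarrow> int \<Rightarrow> real^'d^'d) \<Rightarrow> real \<Rightarrow> bool" where
  "has_chron_radius C \<rho> \<longleftrightarrow>
     (\<forall>m. bdd_above (chron_max C m ` {1..})) \<and>
     (\<lambda>m. root m (SUP b\<in>{1..}. chron_max C m b)) \<longlonglongrightarrow> \<rho>"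

definition match_map :: "real^4^1" where
  "match_map = rowvector (vector [0, 1, 0, 1])"

lemma vector_4 [simp]:
  "(vector [x, y, z, w] :: 'a::zero^4) $ 1 = x"
  "(vector [x, y, z, w] :: 'a::zero^4) $ 2 = y"
  "(vector [x, y, z, w] :: 'a::zero^4) $ 3 = z"
  "(vector [x, y, z, w] :: 'a::zero^4) $ 4 = w"
  unfolding vector_def by auto

lemma rank_match_map: "rank match_map = CARD(1)"
proof -
  have "rows match_map = {vector [0, 1, 0, 1]}"
    by (auto simp: rows_def row_def match_map_def rowvector_def vec_eq_iff)
  moreover have "(vector [0, 1, 0, 1] :: real^4) \<noteq> 0"
    by (auto simp: vec_eq_iff forall_4)
  ultimately show ?thesis
    by (simp add: row_rank_def dim_singleton)
qed

lemma orthonormal_kernel_basis_match_map: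
  "\<exists>U :: real^3^4. orthonormal_kernel_basis match_map U"
proof -
  define s :: real where "s = 1 / sqrt 2"
  have s: "s * s = 1/2" "s \<noteq> 0" by (auto simp: s_def)
  define U :: "real^3^4" where
    "U = vector [vector [1, 0, 0], vector [0, 0, s], vector [0, 1, 0], vector [0, 0, - s]]"
  have "transpose U ** U = mat 1"
    by (auto simp: vec_eq_iff forall_3 matrix_matrix_mult_def transpose_def sum_4 U_def mat_def s)
  moreover have "span (columns U) = {v. match_map *v v = 0}"
  proof
    have "columns U \<subseteq> {v. match_map *v v = 0}"
      by (auto simp: columns_def column_def match_map_def rowvector_def matrix_vector_mult_def
          vec_eq_iff sum_4 U_def) (metis (no_types) exhaust_3 vector_3 add.right_inverse add_0)
    then show "span (columns U) \<subseteq> {v. match_map *v v = 0}"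
      by (intro span_minimal) (auto simp: subspace_def matrix_vector_right_distrib
          matrix_vector_mult_scaleR)
  next
    have "v = U *v vector [v $ 1, v $ 3, v $ 2 / s]" if "match_map *v v = 0" for v
      using that s by (auto simp: match_map_def rowvector_def matrix_vector_mult_def
          vec_eq_iff sum_4 sum_3 forall_4 U_def)
    then show "{v. match_map *v v = 0} \<subseteq> span (columns U)"
      using matrix_vector_mult_in_columnspace by (metis (mono_tags, lifting) mem_Collect_eq subsetI)
  qed
  ultimately show ?thesis unfolding orthonormal_kernel_basis_def by blast
qed


subsection \<open>Entropy and codes\<close>

text \<open>The infimum is \<open>\<infinity>\<close> if there is no finite cover.\<close>

definition covering_number :: "real \<Rightarrow> (real \<Rightarrow> 'a::euclidean_space) set \<Rightarrow> enat" where
  "covering_number \<epsilon> F =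
     (INF S \<in> {S. finite S \<and> (\<forall>c\<in>S. bounded (range c)) \<and>
                   F \<subseteq> (\<Union>c\<in>S. {f. sup_norm (\<lambda>x. f x - c x) \<le> ereal \<epsilon>})}. enat (card S))"

definition entropy :: "real \<Rightarrow> (real \<Rightarrow> 'a::euclidean_space) set \<Rightarrow> ereal" where
  "entropy \<epsilon> F = (case covering_number \<epsilon> F of enat n \<Rightarrow> ereal (log 2 (real n)) | \<infinity> \<Rightarrow> \<infinity>)"

definition fixed_length_code ::
  "(real \<Rightarrow> real) set \<Rightarrow> nat \<Rightarrow> ((real \<Rightarrow> real) \<Rightarrow> bool list) \<Rightarrow> (bool list \<Rightarrow> real \<Rightarrow> real) \<Rightarrow> bool" where
  "fixed_length_code F B E R \<longleftrightarrow>
     (\<forall>f\<in>F. length (E f) = B) \<and> (\<forall>w. length w = B \<longrightarrow> bounded (range (R w)))"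

definition distortion ::
  "(real \<Rightarrow> real) set \<Rightarrow> ((real \<Rightarrow> real) \<Rightarrow> bool list) \<Rightarrow> (bool list \<Rightarrow> real \<Rightarrow> real) \<Rightarrow> ereal" where
  "distortion F E R = (SUP f\<in>F. sup_norm (\<lambda>x. f x - R (E f) x))"


subsection \<open>ReLU networks\<close>

text \<open>An affine map is given by the list of rows of its matrix and its bias vector; a network
  is given by the list of its hidden layers, first layer first, and its output layer.\<close>

type_synonym affine = "real list list \<times> real list"

type_synonym network = "affine list \<times> affine"

definition out_dim :: "affine \<Rightarrow> nat" where
  "out_dim L = length (snd L)"

definition affine_ok :: "nat \<Rightarrow> affine \<Rightarrow> bool" where
  "affine_ok d L \<longleftrightarrow> length (fst L) = length (snd L) \<and> (\<forall>r\<in>set (fst L). length r = d)"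

definition affine_apply :: "affine \<Rightarrow> real list \<Rightarrow> real list" where
  "affine_apply L v = map2 (\<lambda>r \<beta>. (\<Sum>(p, q)\<leftarrow>zip r v. p * q) + \<beta>) (fst L) (snd L)"

definition affine_entries :: "affine \<Rightarrow> real list" where
  "affine_entries L = concat (fst L) @ snd L"

fun hidden_ok :: "nat \<Rightarrow> affine list \<Rightarrow> affine \<Rightarrow> nat \<Rightarrow> bool" where
  "hidden_ok d [] L e \<longleftrightarrow> affine_ok d L \<and> out_dim L = e"
| "hidden_ok d (H # Hs) L e \<longleftrightarrow> affine_ok d H \<and> hidden_ok (out_dim H) Hs L e"

definition network_ok :: "nat \<Rightarrow> nat \<Rightarrow> network \<Rightarrow> bool" where
  "network_ok d e N \<longleftrightarrow> hidden_ok d (fst N) (snd N) e"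

definition network_eval :: "network \<Rightarrow> real list \<Rightarrow> real list" where
  "network_eval N v =
     affine_apply (snd N) (fold (\<lambda>H u. map (\<lambda>y. max y 0) (affine_apply H u)) (fst N) v)"

definition network_width :: "network \<Rightarrow> nat" where
  "network_width N = Max (insert 0 (out_dim ` set (fst N)))"

definition network_depth :: "network \<Rightarrow> nat" where
  "network_depth N = length (fst N)"

definition network_params :: "network \<Rightarrow> real list" where
  "network_params N = concat (map affine_entries (fst N @ [snd N]))"

definition computes :: "network \<Rightarrow> (real \<Rightarrow> real) \<Rightarrow> bool" where
  "computes N f \<longleftrightarrow> network_ok 1 1 N \<and> (\<forall>x. network_eval N [x] = [f x])"

end

theory Submission
  imports Defs
begin

text \<open>The bumps \<open>x \<mapsto> hat (2 ^ k * x - 2)\<close> have pairwise disjoint supports, so every point sees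
  at most one term of a bump series, and the sup-norm of the series is the supremum of its
  coefficients. Hence the class of all \<open>phi a t\<close> is isometric to the box with side lengths
  \<open>a ^ (k - 1)\<close> in the maximum norm. Packing and quantising this box coordinate by coordinate gives
  \<open>\<Sum>k (log (1/\<epsilon>) - k * log (1/a)) + O(log (1/\<epsilon>))\<close> bits, the sum running over the coordinates with
  positive summand; this arithmetic progression is the stated quadratic. The matching map is a
  common left eigenvector of all block matrices, so products of the kernel blocks are restrictions of
  products of block matrices to the kernel, where a suitable maximum norm contracts by the factor
  \<open>a\<close> in each step, and this factor is attained on the first coordinate vector.\<close>

lemma hat_nonneg: "0 \<le> hat x"
  and hat_le_1: "hat x \<le> 1"
  and hat_eq_0: "x \<le> 0 \<or> 2 \<le> x \<Longrightarrow> hat x = 0"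
  by (auto simp: hat_def)

lemma hat_refine: "hat x = hat (2 * x) / 2 + hat (2 * x - 1) + hat (2 * x - 2) / 2"
  by (auto simp: hat_def max_def abs_if field_simps)

lemma infnorm_real: "infnorm (x::real) = \<bar>x\<bar>"
  by (simp add: infnorm_def)

lemma sup_norm_le_iff: "sup_norm f \<le> ereal c \<longleftrightarrow> (\<forall>x. infnorm (f x) \<le> c)"
  by (simp add: sup_norm_def SUP_le_iff)

subsection \<open>Series of disjointly supported bumps\<close>

definition bump :: "nat \<Rightarrow> real \<Rightarrow> real" where
  "bump k x = hat (2 ^ Suc k * x - 2)"

lemma bump_nonneg: "0 \<le> bump k x"
  and bump_le_1: "bump k x \<le> 1"
  by (simp_all add: bump_def hat_nonneg hat_le_1)

lemma bump_double: "bump k (2 * x) = bump (Suc k) x"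
  by (simp add: bump_def mult_ac)

lemma bump_peak: "bump k (3 / 2 ^ Suc k) = 1"
  by (simp add: bump_def hat_def)

lemma bump_support: "bump k x \<noteq> 0 \<Longrightarrow> 1 < 2 ^ k * x \<and> 2 ^ k * x < 2"
  using hat_eq_0[of "2 ^ Suc k * x - 2"] unfolding bump_def power_Suc mult.assoc by linarith

lemma bump_supports_disjoint:
  assumes "bump j x \<noteq> 0" "bump k x \<noteq> 0"
  shows "j = k"
proof -
  have False if "i < l" "bump i x \<noteq> 0" "bump l x \<noteq> 0" for i l
  proof -
    have i: "1 < 2 ^ i * x" and l: "2 ^ l * x < 2"
      using that bump_support by auto
    then have "0 < x"
      by (smt (verit) zero_less_mult_iff zero_less_power)
    moreover have "(2::real) ^ Suc i \<le> 2 ^ l"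
      using \<open>i < l\<close> by (intro power_increasing) auto
    ultimately have "2 ^ Suc i * x \<le> 2 ^ l * x"
      by (intro mult_right_mono) auto
    then show False
      using i l by simp
  qed
  then show ?thesis
    using assms by (metis linorder_neqE_nat)
qed

definition bump_series :: "(nat \<Rightarrow> real) \<Rightarrow> real \<Rightarrow> real" where
  "bump_series c x = (\<Sum>k. c k * bump k x)"

lemma bump_series_on_support:
  assumes "bump k x \<noteq> 0"
  shows "bump_series c x = c k * bump k x"
proof -
  have "c j * bump j x = 0" if "j \<notin> {k}" for j
    using bump_supports_disjoint[OF assms, of j] that by auto
  then show ?thesis
    unfolding bump_series_def by (subst suminf_finite[of "{k}"]) auto
qed

lemma bump_series_eq_single_term:
  obtains k where "\<And>c. bump_series c x = c k * bump k x"
proof (cases "\<exists>k. bump k x \<noteq> 0")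
  case True
  then show thesis
    using that bump_series_on_support by blast
next
  case False
  then show thesis
    by (intro that[of 0]) (simp add: bump_series_def)
qed

lemma bump_series_diff: "bump_series (\<lambda>k. c k - d k) x = bump_series c x - bump_series d x"
proof -
  obtain k where "\<And>c. bump_series c x = c k * bump k x"
    using bump_series_eq_single_term by metis
  then show ?thesis
    by (simp add: left_diff_distrib)
qed

lemma bump_series_eq_sum:
  assumes "\<And>k. k \<ge> n \<Longrightarrow> c k = 0"
  shows "bump_series c x = (\<Sum>k<n. c k * bump k x)"
  unfolding bump_series_def using assms by (intro suminf_finite) auto

lemma bump_series_peak: "bump_series c (3 / 2 ^ Suc k) = c k"
  using bump_series_on_support[of k "3 / 2 ^ Suc k" c] unfolding bump_peak by simp

lemma sup_norm_bump_series: "sup_norm (bump_series c) = (SUP k. ereal \<bar>c k\<bar>)"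
proof (rule antisym)
  show "sup_norm (bump_series c) \<le> (SUP k. ereal \<bar>c k\<bar>)"
    unfolding sup_norm_def
  proof (rule SUP_least)
    fix x
    obtain k where "bump_series c x = c k * bump k x"
      using bump_series_eq_single_term by metis
    then have "infnorm (bump_series c x) \<le> \<bar>c k\<bar>"
      using bump_nonneg bump_le_1 by (simp add: infnorm_real abs_mult mult_left_le)
    then show "ereal (infnorm (bump_series c x)) \<le> (SUP k. ereal \<bar>c k\<bar>)"
      by (intro SUP_upper2[of k]) auto
  qed
  show "(SUP k. ereal \<bar>c k\<bar>) \<le> sup_norm (bump_series c)"
    unfolding sup_norm_def
  proof (rule SUP_least)
    fix k
    show "ereal \<bar>c k\<bar> \<le> (SUP x. ereal (infnorm (bump_series c x)))"
      by (rule SUP_upper2[of "3 / 2 ^ Suc k"])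
        (simp_all only: UNIV_I bump_series_peak infnorm_real order_refl)
  qed
qed

lemma phi_eq_bump_series: "phi a t = bump_series (\<lambda>k. a ^ k * t (Suc k))"
  by (simp add: fun_eq_iff phi_def bump_series_def bump_def)

lemma sup_norm_phi_diff:
  assumes "0 \<le> a"
  shows "sup_norm (\<lambda>x. phi a t x - phi a s x) = (SUP k\<in>{1..}. ereal (a ^ (k - 1) * \<bar>t k - s k\<bar>))"
proof -
  have "sup_norm (\<lambda>x. phi a t x - phi a s x) =
      sup_norm (bump_series (\<lambda>k. a ^ k * (t (Suc k) - s (Suc k))))"
    by (simp add: phi_eq_bump_series right_diff_distrib flip: bump_series_diff)
  also have "\<dots> = (SUP k. ereal (a ^ k * \<bar>t (Suc k) - s (Suc k)\<bar>))"
    using assms by (simp add: sup_norm_bump_series abs_mult)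
  also have "\<dots> = (SUP k\<in>range Suc. ereal (a ^ (k - 1) * \<bar>t k - s k\<bar>))"
    by (simp add: image_image)
  finally show ?thesis
    by (simp flip: greaterThan_0 atLeast_Suc_greaterThan)
qed

lemma sup_norm_phi_diff_le_iff:
  assumes "0 \<le> a"
  shows "sup_norm (\<lambda>x. phi a t x - phi a s x) \<le> ereal \<epsilon> \<longleftrightarrow>
    (\<forall>k\<ge>1. a ^ (k - 1) * \<bar>t k - s k\<bar> \<le> \<epsilon>)"
  using assms by (auto simp: sup_norm_phi_diff SUP_le_iff)

lemma bounded_range_phi:
  assumes "0 \<le> a" "a \<le> 1" "t \<in> unit_seqs"
  shows "bounded (range (phi a t))"
proof -
  have "sup_norm (phi a t) \<le> ereal 1"
    using assms unfolding phi_eq_bump_series sup_norm_bump_series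
    by (intro SUP_least) (auto simp: unit_seqs_def abs_mult power_le_one intro!: mult_le_one)
  then have "\<forall>y\<in>range (phi a t). norm y \<le> 1"
    by (auto simp: sup_norm_le_iff infnorm_real)
  then show ?thesis
    unfolding bounded_iff by blast
qed

subsection \<open>Limit of the cascade\<close>

lemma subdiv_mask_apply:
  "subdiv (subdiv_mask a \<tau>) f x =
    vector [a * f (2 * x) $ 1 + \<tau> * f (2 * x - 2) $ 2,
            f (2 * x) $ 2 / 2 + f (2 * x - 1) $ 2 + f (2 * x - 2) $ 2 / 2]"
proof -
  have "{0..2::int} = {0, 1, 2}" by auto
  then show ?thesis
    by (auto simp: subdiv_def subdiv_mask_def vec_eq_iff forall_2 matrix_vector_mult_def sum_2)
qed

lemma foldr_subdiv_gen:
  "foldr (\<lambda>k. subdiv (subdiv_mask a (t k))) [b..<b + n] gen x =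
    vector [\<Sum>k<n. a ^ k * t (b + k) * bump k x, hat x]"
proof (induction n arbitrary: b x)
  case 0
  then show ?case by (simp add: gen_def)
next
  case (Suc n)
  have "foldr (\<lambda>k. subdiv (subdiv_mask a (t k))) [b..<b + Suc n] gen =
    subdiv (subdiv_mask a (t b)) (foldr (\<lambda>k. subdiv (subdiv_mask a (t k))) [Suc b..<Suc b + n] gen)"
    by (subst upt_conv_Cons) (auto simp del: upt_Suc)
  then have "foldr (\<lambda>k. subdiv (subdiv_mask a (t k))) [b..<b + Suc n] gen x =
    subdiv (subdiv_mask a (t b))
      (foldr (\<lambda>k. subdiv (subdiv_mask a (t k))) [Suc b..<Suc b + n] gen) x"
    by (rule fun_cong)
  then show ?case
    unfolding subdiv_mask_apply[of a "t b"] Suc.IH sum.lessThan_Suc_shift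
    by (simp add: hat_refine[of x] bump_def[of 0] sum_distrib_left mult_ac add.commute
        flip: bump_double del: upt_Suc)
qed

lemma cascade_minus_Phi:
  "cascade (\<lambda>k. subdiv (subdiv_mask a (t k))) n gen x - Phi a t x =
    vector [- bump_series (\<lambda>k. if k < n then 0 else a ^ k * t (Suc k)) x, 0]"
proof -
  let ?c = "\<lambda>k. a ^ k * t (Suc k)"
  have "(\<Sum>k<n. ?c k * bump k x) = bump_series (\<lambda>k. if k < n then ?c k else 0) x"
    by (subst bump_series_eq_sum[of n]) auto
  also have "\<dots> = bump_series (\<lambda>k. ?c k - (if k < n then 0 else ?c k)) x"
    by (intro arg_cong[where f = "\<lambda>c. bump_series c x"]) auto
  also have "\<dots> = phi a t x - bump_series (\<lambda>k. if k < n then 0 else ?c k) x"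
    by (simp add: bump_series_diff phi_eq_bump_series)
  finally show ?thesis
    using foldr_subdiv_gen[where b = 1 and n = n]
    by (simp add: cascade_def Phi_def vec_eq_iff forall_2)
qed

lemma sup_norm_cascade_minus_Phi_le:
  assumes "0 \<le> a" "a \<le> 1" "t \<in> unit_seqs"
  shows "sup_norm (\<lambda>x. cascade (\<lambda>k. subdiv (subdiv_mask a (t k))) n gen x - Phi a t x)
    \<le> ereal (a ^ n)"
proof -
  define r where "r k = (if k < n then 0 else a ^ k * t (Suc k))" for k
  have "\<bar>r k\<bar> \<le> a ^ n" for k
  proof (cases "k < n")
    case False
    have "\<bar>r k\<bar> = a ^ k * t (Suc k)" "t (Suc k) \<le> 1"
      using False assms by (auto simp: r_def unit_seqs_def)
    then have "\<bar>r k\<bar> \<le> a ^ k"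
      using assms by (simp add: mult_left_le)
    also have "\<dots> \<le> a ^ n"
      using False assms by (intro power_decreasing) auto
    finally show ?thesis .
  qed (use assms in \<open>simp add: r_def\<close>)
  then have "sup_norm (bump_series r) \<le> ereal (a ^ n)"
    unfolding sup_norm_bump_series by (intro SUP_least) auto
  then show ?thesis
    by (simp add: cascade_minus_Phi sup_norm_le_iff infnorm_2 infnorm_real r_def[abs_def])
qed

subsection \<open>Chronological radius of matched masks\<close>

lemma span_columns_eq_range: "span (columns U) = range ((*v) (U :: real^'d^'n))"
proof
  have "columns U \<subseteq> range ((*v) U)"
    by (auto simp: columns_def simp flip: matrix_vector_mult_basis)
  moreover have "subspace (range ((*v) U))"
    by (intro linear_subspace_image matrix_vector_mul_linear subspace_UNIV)
  ultimately show "span (columns U) \<subseteq> range ((*v) U)"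
    by (rule span_minimal)
qed (use matrix_vector_mult_in_columnspace in auto)

lemma orthonormal_kernel_basis_in_kernel:
  assumes "orthonormal_kernel_basis P U"
  shows "P *v (U *v y) = 0"
  using assms by (auto simp: orthonormal_kernel_basis_def span_columns_eq_range)

lemma norm_orthonormal_kernel_basis:
  fixes U :: "real^'d^'n"
  assumes "orthonormal_kernel_basis P U"
  shows "norm (U *v y) = norm y"
proof -
  have "(U *v y) \<bullet> (U *v y) = (transpose U ** U *v y) \<bullet> y"
    by (simp add: dot_lmul_matrix transpose_matrix_vector flip: matrix_vector_mul_assoc)
  also have "transpose U ** U = mat 1"
    using assms by (simp add: orthonormal_kernel_basis_def)
  finally show ?thesis
    by (simp add: norm_eq_sqrt_inner)
qed

lemma orthonormal_kernel_basis_expansion: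
  assumes "orthonormal_kernel_basis P U" "P *v v = 0"
  shows "U *v (transpose U *v v) = v"
proof -
  obtain y where y: "v = U *v y"
    using assms by (auto simp: orthonormal_kernel_basis_def span_columns_eq_range)
  have "transpose U *v v = y"
    using assms by (simp add: y orthonormal_kernel_basis_def matrix_vector_mul_assoc)
  then show ?thesis
    using y by simp
qed

lemma chron_max_le:
  assumes "\<And>w. set w \<subseteq> {0, 1} \<Longrightarrow> length w = m \<Longrightarrow> op_norm (chron_prod C b w) \<le> r"
  shows "chron_max C m b \<le> r"
  unfolding chron_max_def
proof (rule Max.boundedI)
  show "finite ((\<lambda>w. op_norm (chron_prod C b w)) ` {w. set w \<subseteq> {0, 1} \<and> length w = m})"
    by (intro finite_imageI finite_lists_length_eq) auto
  have "replicate m 0 \<in> {w. set w \<subseteq> {0, 1::int} \<and> length w = m}"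
    by auto
  then show "(\<lambda>w. op_norm (chron_prod C b w)) ` {w. set w \<subseteq> {0, 1} \<and> length w = m} \<noteq> {}"
    by blast
qed (use assms in auto)

lemma op_norm_chron_prod_le_chron_max:
  assumes "set w \<subseteq> {0, 1}"
  shows "op_norm (chron_prod C b w) \<le> chron_max C (length w) b"
  unfolding chron_max_def using assms
  by (intro Max_ge finite_imageI imageI finite_lists_length_eq) auto

lemma has_chron_radiusI:
  assumes "0 < \<rho>" "0 < c"
    and lower: "\<And>m b. b \<ge> 1 \<Longrightarrow> c * \<rho> ^ m \<le> chron_max C m b"
    and upper: "\<And>m b. b \<ge> 1 \<Longrightarrow> chron_max C m b \<le> K * \<rho> ^ m"
  shows "has_chron_radius C \<rho>"
proof -
  define X where "X m = (SUP b\<in>{1..}. chron_max C m b)" for m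
  have bdd: "bdd_above (chron_max C m ` {1..})" for m
    using upper by (intro bdd_aboveI2[where M = "K * \<rho> ^ m"]) auto
  have X_le: "X m \<le> K * \<rho> ^ m" for m
    unfolding X_def using upper by (intro cSUP_least) auto
  have X_ge: "c * \<rho> ^ m \<le> X m" for m
    unfolding X_def using lower bdd by (intro cSUP_upper2[of _ _ 1]) auto
  have "0 < K"
    using X_le[of 0] X_ge[of 0] \<open>0 < c\<close> by simp
  have root_lim: "(\<lambda>m. root m k * \<rho>) \<longlonglongrightarrow> \<rho>" if "0 < k" for k
    using tendsto_mult[OF LIMSEQ_root_const[OF that] tendsto_const[of \<rho>]] by simp
  have root_scaled: "root m (k * \<rho> ^ m) = root m k * \<rho>" if "0 < m" for m k
    using that \<open>0 < \<rho>\<close> by (simp add: real_root_mult real_root_power_cancel)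
  have "(\<lambda>m. root m (X m)) \<longlonglongrightarrow> \<rho>"
  proof (rule tendsto_sandwich)
    show "\<forall>\<^sub>F m in sequentially. root m c * \<rho> \<le> root m (X m)"
      using eventually_gt_at_top[of 0]
      by eventually_elim (metis root_scaled real_root_le_mono X_ge)
    show "\<forall>\<^sub>F m in sequentially. root m (X m) \<le> root m K * \<rho>"
      using eventually_gt_at_top[of 0]
      by eventually_elim (metis root_scaled real_root_le_mono X_le)
  qed (use root_lim \<open>0 < c\<close> \<open>0 < K\<close> in auto)
  then show ?thesis
    using bdd unfolding has_chron_radius_def X_def by blast
qed

locale matched_masks =
  fixes P :: "nat \<Rightarrow> real^4^'r" and U :: "nat \<Rightarrow> real^'d^4" and A :: "nat \<Rightarrow> int \<Rightarrow> real^2^2"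
  assumes basis: "k \<ge> 1 \<Longrightarrow> orthonormal_kernel_basis (P k) (U k)"
    and kernel_invariant: "k \<ge> 1 \<Longrightarrow> \<epsilon> \<in> {0, 1} \<Longrightarrow> P (Suc k) *v v = 0 \<Longrightarrow>
      P k *v (block_matrix (A k) \<epsilon> *v v) = 0"
begin

abbreviation block_prod :: "nat \<Rightarrow> int list \<Rightarrow> real^4^4" where
  "block_prod \<equiv> chron_prod (\<lambda>k. block_matrix (A k))"

abbreviation kernel_prod :: "nat \<Rightarrow> int list \<Rightarrow> real^'d^'d" where
  "kernel_prod \<equiv> chron_prod (kernel_block U A)"

lemma block_prod_in_kernel:
  assumes "b \<ge> 1" "set w \<subseteq> {0, 1}" "P (b + length w) *v v = 0"
  shows "P b *v (block_prod b w *v v) = 0"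
  using assms
proof (induction w arbitrary: b)
  case (Cons \<epsilon> w)
  then have "P (Suc b) *v (block_prod (Suc b) w *v v) = 0"
    by simp
  then show ?case
    using Cons.prems kernel_invariant by (simp flip: matrix_vector_mul_assoc)
qed simp

lemma basis_kernel_prod:
  assumes "b \<ge> 1" "set w \<subseteq> {0, 1}"
  shows "U b *v (kernel_prod b w *v y) = block_prod b w *v (U (b + length w) *v y)"
  using assms
proof (induction w arbitrary: b)
  case (Cons \<epsilon> w)
  let ?v = "block_prod (Suc b) w *v (U (Suc b + length w) *v y)"
  have IH: "U (Suc b) *v (kernel_prod (Suc b) w *v y) = ?v"
    using Cons by simp
  have "P (Suc b) *v ?v = 0"
    using Cons.prems orthonormal_kernel_basis_in_kernel[OF basis]
    by (intro block_prod_in_kernel) auto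
  then have "U b *v (transpose (U b) *v (block_matrix (A b) \<epsilon> *v ?v)) = block_matrix (A b) \<epsilon> *v ?v"
    using Cons.prems by (intro orthonormal_kernel_basis_expansion[OF basis] kernel_invariant) auto
  then show ?case
    using IH by (simp add: kernel_block_def[of U A b] del: transpose_matrix_vector
        flip: matrix_vector_mul_assoc)
qed simp

lemma norm_kernel_prod:
  assumes "b \<ge> 1" "set w \<subseteq> {0, 1}"
  shows "norm (kernel_prod b w *v y) = norm (block_prod b w *v (U (b + length w) *v y))"
  using norm_orthonormal_kernel_basis[OF basis[OF assms(1)]] basis_kernel_prod[OF assms] by metis

lemma gauge_block_prod_le:
  fixes N :: "real^4 \<Rightarrow> real"
  assumes contraction: "\<And>k \<epsilon> v. k \<ge> 1 \<Longrightarrow> \<epsilon> \<in> {0, 1} \<Longrightarrow> P (Suc k) *v v = 0 \<Longrightarrow>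
      N (block_matrix (A k) \<epsilon> *v v) \<le> \<rho> * N v"
    and "0 \<le> \<rho>" "b \<ge> 1" "set w \<subseteq> {0, 1}" "P (b + length w) *v v = 0"
  shows "N (block_prod b w *v v) \<le> \<rho> ^ length w * N v"
  using assms(3-5)
proof (induction w arbitrary: b)
  case (Cons \<epsilon> w)
  let ?z = "block_prod (Suc b) w *v v"
  have "N (block_matrix (A b) \<epsilon> *v ?z) \<le> \<rho> * N ?z"
    using Cons.prems by (intro contraction block_prod_in_kernel) auto
  also have "\<dots> \<le> \<rho> * (\<rho> ^ length w * N v)"
    using Cons.prems \<open>0 \<le> \<rho>\<close> by (intro mult_left_mono Cons.IH) auto
  finally show ?case
    by (simp add: mult.assoc flip: matrix_vector_mul_assoc)
qed simp

lemma op_norm_kernel_prod_le: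
  fixes N :: "real^4 \<Rightarrow> real"
  assumes contraction: "\<And>k \<epsilon> v. k \<ge> 1 \<Longrightarrow> \<epsilon> \<in> {0, 1} \<Longrightarrow> P (Suc k) *v v = 0 \<Longrightarrow>
      N (block_matrix (A k) \<epsilon> *v v) \<le> \<rho> * N v"
    and gauge_le_norm: "\<And>v. N v \<le> c * norm v"
    and norm_le_gauge: "\<And>k v. k \<ge> 1 \<Longrightarrow> P k *v v = 0 \<Longrightarrow> norm v \<le> d * N v"
    and "0 \<le> \<rho>" "0 \<le> d" "b \<ge> 1" "set w \<subseteq> {0, 1}"
  shows "op_norm (kernel_prod b w) \<le> d * c * \<rho> ^ length w"
  unfolding op_norm_def
proof (rule onorm_le)
  fix y
  define v where "v = U (b + length w) *v y"
  have ker: "P (b + length w) *v v = 0" and norm_v: "norm v = norm y"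
    using orthonormal_kernel_basis_in_kernel[OF basis] norm_orthonormal_kernel_basis[OF basis]
      \<open>b \<ge> 1\<close> by (simp_all add: v_def)
  have "norm (kernel_prod b w *v y) = norm (block_prod b w *v v)"
    using assms by (simp add: norm_kernel_prod v_def)
  also have "\<dots> \<le> d * N (block_prod b w *v v)"
    using assms ker by (intro norm_le_gauge[of b] block_prod_in_kernel)
  also have "\<dots> \<le> d * (\<rho> ^ length w * N v)"
    using assms ker by (intro mult_left_mono gauge_block_prod_le contraction)
  also have "\<dots> \<le> d * (\<rho> ^ length w * (c * norm v))"
    using assms by (intro mult_left_mono gauge_le_norm) auto
  finally show "norm (kernel_prod b w *v y) \<le> d * c * \<rho> ^ length w * norm y"
    by (simp add: norm_v mult_ac)
qed

lemma op_norm_kernel_prod_ge: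
  assumes eigenvector: "\<And>k. k \<ge> 1 \<Longrightarrow> block_matrix (A k) 0 *v v = \<rho> *\<^sub>R v"
    and "\<And>k. k \<ge> 1 \<Longrightarrow> P k *v v = 0" "v \<noteq> 0" "b \<ge> 1"
  shows "\<rho> ^ m \<le> op_norm (kernel_prod b (replicate m 0))"
proof -
  let ?M = "kernel_prod b (replicate m 0)"
  define y where "y = transpose (U (b + m)) *v v"
  have v: "U (b + m) *v y = v"
    unfolding y_def using assms by (intro orthonormal_kernel_basis_expansion[OF basis]) auto
  have norm_v: "norm v = norm y"
    using norm_orthonormal_kernel_basis[OF basis, of "b + m" y] \<open>b \<ge> 1\<close> v by simp
  have power_eigenvector: "block_prod k (replicate m 0) *v v = \<rho> ^ m *\<^sub>R v" if "k \<ge> 1" for k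
    using that
    by (induction m arbitrary: k)
      (simp_all add: eigenvector matrix_vector_mult_scaleR flip: matrix_vector_mul_assoc)
  have "norm (?M *v y) = norm (block_prod b (replicate m 0) *v v)"
    using norm_kernel_prod[of b "replicate m 0" y] \<open>b \<ge> 1\<close> v by (simp add: set_replicate_conv_if)
  then have "\<bar>\<rho> ^ m\<bar> * norm y = norm (?M *v y)"
    using power_eigenvector \<open>b \<ge> 1\<close> norm_v by simp
  also have "\<dots> \<le> op_norm ?M * norm y"
    unfolding op_norm_def by (intro onorm matrix_vector_mul_bounded_linear)
  finally have "\<bar>\<rho> ^ m\<bar> \<le> op_norm ?M"
    using norm_v \<open>v \<noteq> 0\<close> by (metis mult_right_le_imp_le zero_less_norm_iff)
  then show ?thesis
    by linarith
qed

lemma has_chron_radius_extremal_gauge: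
  fixes N :: "real^4 \<Rightarrow> real"
  assumes contraction: "\<And>k \<epsilon> v. k \<ge> 1 \<Longrightarrow> \<epsilon> \<in> {0, 1} \<Longrightarrow> P (Suc k) *v v = 0 \<Longrightarrow>
      N (block_matrix (A k) \<epsilon> *v v) \<le> \<rho> * N v"
    and gauge_le_norm: "\<And>v. N v \<le> c * norm v"
    and norm_le_gauge: "\<And>k v. k \<ge> 1 \<Longrightarrow> P k *v v = 0 \<Longrightarrow> norm v \<le> d * N v"
    and eigenvector: "\<And>k. k \<ge> 1 \<Longrightarrow> block_matrix (A k) 0 *v u = \<rho> *\<^sub>R u"
    and in_kernel: "\<And>k. k \<ge> 1 \<Longrightarrow> P k *v u = 0"
    and "u \<noteq> 0" "0 < \<rho>" "0 \<le> d"
  shows "has_chron_radius (kernel_block U A) \<rho>"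
proof (rule has_chron_radiusI)
  show "chron_max (kernel_block U A) m b \<le> d * c * \<rho> ^ m" if "b \<ge> 1" for m b
  proof (rule chron_max_le)
    fix w :: "int list"
    assume "set w \<subseteq> {0, 1}" and len: "length w = m"
    then have "op_norm (kernel_prod b w) \<le> d * c * \<rho> ^ length w"
      using that \<open>0 < \<rho>\<close> \<open>0 \<le> d\<close>
      by (intro op_norm_kernel_prod_le[where N = N] contraction gauge_le_norm norm_le_gauge) simp_all
    then show "op_norm (kernel_prod b w) \<le> d * c * \<rho> ^ m"
      by (simp add: len)
  qed
  show "1 * \<rho> ^ m \<le> chron_max (kernel_block U A) m b" if "b \<ge> 1" for m b
  proof -
    have "\<rho> ^ m \<le> op_norm (kernel_prod b (replicate m 0))"
      using \<open>u \<noteq> 0\<close> that by (intro op_norm_kernel_prod_ge[of u] eigenvector in_kernel)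
    also have "\<dots> \<le> chron_max (kernel_block U A) (length (replicate m (0::int))) b"
      by (intro op_norm_chron_prod_le_chron_max) auto
    finally show ?thesis by simp
  qed
qed (use \<open>0 < \<rho>\<close> in auto)

end

lemma match_map_apply: "match_map *v v = vec (v $ 2 + v $ 4)"
  by (auto simp: match_map_def rowvector_def matrix_vector_mult_def vec_eq_iff sum_4)

lemma match_map_eq_0_iff: "match_map *v v = 0 \<longleftrightarrow> v $ 4 = - v $ 2"
  by (auto simp: match_map_apply vec_eq_iff)

lemma block_matrix_subdiv_mask_apply:
  "block_matrix (subdiv_mask a \<tau>) 0 *v v =
    vector [a * v $ 1, v $ 2 / 2, \<tau> * v $ 2, v $ 2 / 2 + v $ 4]"
  "block_matrix (subdiv_mask a \<tau>) 1 *v v =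
    vector [a * v $ 3, v $ 2 + v $ 4 / 2, \<tau> * v $ 4, v $ 4 / 2]"
  by (auto simp: vec_eq_iff forall_4 matrix_vector_mult_def sum_4 block_matrix_def
      subdiv_mask_def block_idx_def inner_idx_def)

lemma match_map_block_matrix:
  assumes "\<epsilon> \<in> {0, 1}"
  shows "match_map ** block_matrix (subdiv_mask a \<tau>) \<epsilon> = match_map"
proof -
  have "match_map *v (block_matrix (subdiv_mask a \<tau>) \<epsilon> *v v) = match_map *v v" for v
    unfolding match_map_apply using assms by (auto simp: block_matrix_subdiv_mask_apply)
  then show ?thesis
    by (simp add: matrix_eq flip: matrix_vector_mul_assoc)
qed

lemma defect_eq_0I:
  fixes P :: "nat \<Rightarrow> real^4^'r" and U :: "nat \<Rightarrow> real^'d^4"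
  assumes "\<And>\<epsilon>. \<epsilon> \<in> {0, 1} \<Longrightarrow> P k ** block_matrix (A k) \<epsilon> = P (Suc k)"
    and "\<And>x. P k *v block_state (\<lambda>y. subdiv (A k) g y - g y) x = 0"
  shows "defect P U A g k = 0"
proof -
  have "op_norm (0 :: real^('d + 'r)^'r) = 0"
    by (simp add: op_norm_def onorm_eq_0)
  then show ?thesis
    using assms by (simp add: defect_def flip: zero_ereal_def)
qed

lemma defect_match_map: "defect (\<lambda>_. match_map) U (\<lambda>k. subdiv_mask a (t k)) gen k = 0"
proof (rule defect_eq_0I)
  show "match_map *v block_state (\<lambda>y. subdiv (subdiv_mask a (t k)) gen y - gen y) x = 0" for x
    unfolding match_map_eq_0_iff
    by (simp add: block_state_def subdiv_mask_apply gen_def hat_refine[of x] hat_refine[of "x + 1"])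
qed (rule match_map_block_matrix)

text \<open>On the kernel of \<^const>\<open>match_map\<close> the fourth coordinate is minus the second. Both block
  matrices halve the second coordinate there and feed it, scaled by \<open>\<tau> \<le> 1\<close>, into the third; the
  weight \<open>2\<close> makes each of these effects a contraction by \<open>1/2 \<le> a\<close>.\<close>

definition ker_gauge :: "real^4 \<Rightarrow> real" where
  "ker_gauge v = max \<bar>v $ 1\<bar> (max (2 * \<bar>v $ 2\<bar>) \<bar>v $ 3\<bar>)"

lemma abs_le_ker_gauge:
  "\<bar>v $ 1\<bar> \<le> ker_gauge v" "2 * \<bar>v $ 2\<bar> \<le> ker_gauge v" "\<bar>v $ 3\<bar> \<le> ker_gauge v"
  by (auto simp: ker_gauge_def)

lemma ker_gauge_le_norm: "ker_gauge v \<le> 2 * norm v"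
  using component_le_norm_cart[of v 1] component_le_norm_cart[of v 2] component_le_norm_cart[of v 3]
  by (auto simp: ker_gauge_def)

lemma norm_le_ker_gauge:
  assumes "match_map *v v = 0"
  shows "norm v \<le> 3 * ker_gauge v"
proof -
  have "norm v \<le> (\<Sum>i\<in>UNIV. \<bar>v $ i\<bar>)"
    by (rule norm_le_l1_cart)
  also have "\<dots> \<le> 3 * ker_gauge v"
  proof -
    have "\<bar>v $ 4\<bar> = \<bar>v $ 2\<bar>"
      using assms by (simp add: match_map_eq_0_iff)
    then show ?thesis
      using abs_le_ker_gauge[of v] unfolding sum_4 by linarith
  qed
  finally show ?thesis .
qed

lemma ker_gauge_block_matrix_le:
  assumes "1/2 \<le> a" "0 \<le> \<tau>" "\<tau> \<le> 1" "\<epsilon> \<in> {0, 1}" "match_map *v v = 0"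
  shows "ker_gauge (block_matrix (subdiv_mask a \<tau>) \<epsilon> *v v) \<le> a * ker_gauge v"
proof -
  note gauge = abs_le_ker_gauge[of v]
  have "1/2 * ker_gauge v \<le> a * ker_gauge v"
    using assms gauge by (intro mult_right_mono) auto
  then have second: "\<bar>v $ 2\<bar> \<le> a * ker_gauge v"
    using gauge by linarith
  have "\<tau> * \<bar>v $ 2\<bar> \<le> \<bar>v $ 2\<bar>"
    using assms by (intro mult_left_le_one_le) auto
  then have third: "\<tau> * \<bar>v $ 2\<bar> \<le> a * ker_gauge v"
    using second by linarith
  have first: "a * \<bar>v $ 1\<bar> \<le> a * ker_gauge v" "a * \<bar>v $ 3\<bar> \<le> a * ker_gauge v"
    using assms gauge by (auto intro: mult_left_mono)
  have "v $ 4 = - v $ 2"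
    using assms by (simp add: match_map_eq_0_iff)
  then show ?thesis
    using assms(1-4) first second third
    by (auto simp: block_matrix_subdiv_mask_apply ker_gauge_def[of "vector _"] abs_mult)
qed

lemma has_chron_radius_match_map:
  fixes U :: "nat \<Rightarrow> real^'d^4"
  assumes "\<And>k. k \<ge> 1 \<Longrightarrow> orthonormal_kernel_basis match_map (U k)" "1/2 \<le> a" "t \<in> unit_seqs"
  shows "has_chron_radius (kernel_block U (\<lambda>k. subdiv_mask a (t k))) a"
proof -
  interpret matched_masks "\<lambda>_. match_map" U "\<lambda>k. subdiv_mask a (t k)"
    by unfold_locales (use assms in \<open>simp_all add: match_map_block_matrix matrix_vector_mul_assoc\<close>)
  have contraction: "ker_gauge (block_matrix (subdiv_mask a (t k)) \<epsilon> *v v) \<le> a * ker_gauge v"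
    if "k \<ge> 1" "\<epsilon> \<in> {0, 1}" "match_map *v v = 0" for k \<epsilon> v
    using that assms by (intro ker_gauge_block_matrix_le) (auto simp: unit_seqs_def)
  define u :: "real^4" where "u = vector [1, 0, 0, 0]"
  have eigenvector: "block_matrix (subdiv_mask a (t k)) 0 *v u = a *\<^sub>R u" for k
    by (simp add: block_matrix_subdiv_mask_apply u_def vec_eq_iff forall_4)
  have "match_map *v u = 0" "u \<noteq> 0"
    by (simp add: match_map_eq_0_iff u_def) (simp add: u_def vec_eq_iff forall_4)
  then show ?thesis
    using has_chron_radius_extremal_gauge[of ker_gauge a 2 3 u] contraction ker_gauge_le_norm
      norm_le_ker_gauge eigenvector \<open>1/2 \<le> a\<close> by auto
qed

subsection \<open>Covering numbers and codes\<close>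

definition is_cover :: "real \<Rightarrow> (real \<Rightarrow> 'a::euclidean_space) set \<Rightarrow> (real \<Rightarrow> 'a) set \<Rightarrow> bool" where
  "is_cover \<epsilon> F S \<longleftrightarrow> finite S \<and> (\<forall>c\<in>S. bounded (range c)) \<and>
     (\<forall>f\<in>F. \<exists>c\<in>S. sup_norm (\<lambda>x. f x - c x) \<le> ereal \<epsilon>)"

lemma covering_number_eq: "covering_number \<epsilon> F = (INF S\<in>{S. is_cover \<epsilon> F S}. enat (card S))"
proof -
  have "F \<subseteq> (\<Union>c\<in>S. {f. sup_norm (\<lambda>x. f x - c x) \<le> ereal \<epsilon>}) \<longleftrightarrow>
    (\<forall>f\<in>F. \<exists>c\<in>S. sup_norm (\<lambda>x. f x - c x) \<le> ereal \<epsilon>)" for S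
    by auto
  then show ?thesis
    by (simp add: covering_number_def is_cover_def)
qed

lemma covering_number_le: "is_cover \<epsilon> F S \<Longrightarrow> covering_number \<epsilon> F \<le> enat (card S)"
  unfolding covering_number_eq by (rule INF_lower) auto

lemma covering_number_ge:
  "(\<And>S. is_cover \<epsilon> F S \<Longrightarrow> n \<le> enat (card S)) \<Longrightarrow> n \<le> covering_number \<epsilon> F"
  unfolding covering_number_eq by (rule INF_greatest) auto

lemma sup_norm_diff_triangle:
  assumes "sup_norm (\<lambda>x. f x - h x) \<le> ereal r" "sup_norm (\<lambda>x. g x - h x) \<le> ereal s"
  shows "sup_norm (\<lambda>x. f x - g x) \<le> ereal (r + s)"
  unfolding sup_norm_le_iff
proof
  fix x
  have "infnorm (f x - g x) \<le> infnorm (f x - h x) + infnorm (h x - g x)"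
    using infnorm_triangle[of "f x - h x" "h x - g x"] by simp
  also have "\<dots> \<le> r + s"
    using assms by (auto simp: sup_norm_le_iff infnorm_sub[of "h x"] intro: add_mono)
  finally show "infnorm (f x - g x) \<le> r + s" .
qed

lemma covering_number_ge_packing:
  fixes f :: "'i \<Rightarrow> real \<Rightarrow> 'a::euclidean_space"
  assumes mem: "\<And>i. i \<in> I \<Longrightarrow> f i \<in> F"
    and separated: "\<And>i j. i \<in> I \<Longrightarrow> j \<in> I \<Longrightarrow> sup_norm (\<lambda>x. f i x - f j x) \<le> ereal (2 * \<epsilon>) \<Longrightarrow> i = j"
  shows "enat (card I) \<le> covering_number \<epsilon> F"
proof (rule covering_number_ge)
  fix S
  assume S: "is_cover \<epsilon> F S"
  then have "\<forall>i\<in>I. \<exists>c\<in>S. sup_norm (\<lambda>x. f i x - c x) \<le> ereal \<epsilon>"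
    using mem by (auto simp: is_cover_def)
  then obtain c where c: "\<And>i. i \<in> I \<Longrightarrow> c i \<in> S"
    "\<And>i. i \<in> I \<Longrightarrow> sup_norm (\<lambda>x. f i x - c i x) \<le> ereal \<epsilon>"
    by metis
  have "inj_on c I"
  proof (rule inj_onI)
    fix i j
    assume ij: "i \<in> I" "j \<in> I" "c i = c j"
    then have "sup_norm (\<lambda>x. f i x - f j x) \<le> ereal (\<epsilon> + \<epsilon>)"
      using c(2)[OF ij(1)] c(2)[OF ij(2)]
      by (intro sup_norm_diff_triangle[where h = "c i"]) simp_all
    then show "i = j"
      using ij separated by simp
  qed
  moreover have "c ` I \<subseteq> S" "finite S"
    using c S by (auto simp: is_cover_def)
  ultimately show "enat (card I) \<le> enat (card S)"
    by (simp add: card_inj_on_le)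
qed

lemma covering_number_le_transfer:
  fixes h :: "(real \<Rightarrow> 'b::euclidean_space) \<Rightarrow> real \<Rightarrow> 'a::euclidean_space"
  assumes bounded: "\<And>c. bounded (range c) \<Longrightarrow> bounded (range (h c))"
    and approx: "\<And>f. f \<in> F \<Longrightarrow> \<exists>g\<in>G. \<forall>c. sup_norm (\<lambda>x. g x - c x) \<le> ereal \<epsilon> \<longrightarrow>
      sup_norm (\<lambda>x. f x - h c x) \<le> ereal \<epsilon>"
  shows "covering_number \<epsilon> F \<le> covering_number \<epsilon> G"
proof (rule covering_number_ge)
  fix S
  assume S: "is_cover \<epsilon> G S"
  have "\<exists>c\<in>h ` S. sup_norm (\<lambda>x. f x - c x) \<le> ereal \<epsilon>" if "f \<in> F" for f
    using approx[OF that] S unfolding is_cover_def by blast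
  then have "is_cover \<epsilon> F (h ` S)"
    using bounded S by (auto simp: is_cover_def)
  then have "covering_number \<epsilon> F \<le> enat (card (h ` S))"
    by (rule covering_number_le)
  also have "\<dots> \<le> enat (card S)"
    using S by (simp add: is_cover_def card_image_le)
  finally show "covering_number \<epsilon> F \<le> enat (card S)" .
qed

lemma covering_number_second_component:
  fixes F :: "(real \<Rightarrow> real) set" and h :: "real \<Rightarrow> real"
  assumes "bounded (range h)" "0 \<le> \<epsilon>"
  shows "covering_number \<epsilon> ((\<lambda>f x. vector [f x, h x] :: real^2) ` F) = covering_number \<epsilon> F"
proof -
  define pair where "pair f x = (vector [f x, h x] :: real^2)" for f x
  have "covering_number \<epsilon> (pair ` F) \<le> covering_number \<epsilon> F"
  proof (rule covering_number_le_transfer)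
    fix c :: "real \<Rightarrow> real"
    assume "bounded (range c)"
    then obtain M N where "\<And>x. \<bar>c x\<bar> \<le> M" "\<And>x. \<bar>h x\<bar> \<le> N"
      using assms(1) by (auto simp: bounded_iff)
    then have "norm (pair c x) \<le> M + N" for x
      using norm_le_l1_cart[of "pair c x"] add_mono[of "\<bar>c x\<bar>" M "\<bar>h x\<bar>" N]
      by (simp add: pair_def sum_2)
    then show "bounded (range (pair c))"
      by (auto simp: bounded_iff)
  next
    fix f
    assume "f \<in> pair ` F"
    then obtain g where "g \<in> F" "f = pair g" by blast
    then show "\<exists>g\<in>F. \<forall>c. sup_norm (\<lambda>x. g x - c x) \<le> ereal \<epsilon> \<longrightarrow>
        sup_norm (\<lambda>x. f x - pair c x) \<le> ereal \<epsilon>"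
      using assms(2)
      by (intro bexI[of _ g]) (auto simp: pair_def sup_norm_le_iff infnorm_2 infnorm_real)
  qed
  moreover have "covering_number \<epsilon> F \<le> covering_number \<epsilon> (pair ` F)"
  proof (rule covering_number_le_transfer)
    fix c :: "real \<Rightarrow> real^2"
    assume "bounded (range c)"
    then show "bounded (range (\<lambda>x. c x $ 1))"
      using bounded_component_cart[of "range c" 1] by (simp add: image_image)
  next
    fix f
    assume "f \<in> F"
    then show "\<exists>g\<in>pair ` F. \<forall>c. sup_norm (\<lambda>x. g x - c x) \<le> ereal \<epsilon> \<longrightarrow>
        sup_norm (\<lambda>x. f x - c x $ 1) \<le> ereal \<epsilon>"
      by (intro bexI[of _ "pair f"]) (auto simp: pair_def sup_norm_le_iff infnorm_2 infnorm_real)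
  qed
  ultimately show ?thesis
    unfolding pair_def[abs_def] by (rule antisym)
qed

lemma entropy_Phi_eq_entropy_phi:
  assumes "0 \<le> \<epsilon>"
  shows "entropy \<epsilon> (Phi a ` T) = entropy \<epsilon> (phi a ` T)"
proof -
  have "bounded (range hat)"
    unfolding bounded_iff using hat_nonneg hat_le_1 by (intro exI[of _ 1]) auto
  moreover have "Phi a ` T = (\<lambda>f x. vector [f x, hat x]) ` phi a ` T"
    by (auto simp: Phi_def[abs_def] image_image)
  ultimately show ?thesis
    using covering_number_second_component[of hat \<epsilon> "phi a ` T"] assms by (simp add: entropy_def)
qed

lemma entropy_le:
  assumes "covering_number \<epsilon> F \<le> enat n"
  shows "entropy \<epsilon> F \<le> ereal (log 2 (real n))"
proof -
  obtain m where m: "covering_number \<epsilon> F = enat m" "m \<le> n"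
    using assms by (cases "covering_number \<epsilon> F") auto
  have "log 2 (real m) \<le> log 2 (real n)"
  proof (cases "m = 0")
    case True
    \<comment> \<open>\<open>log 2 0 = 0\<close>\<close>
    then show ?thesis by (cases "n = 0") (auto simp: log_def)
  qed (use m in auto)
  then show ?thesis
    using m by (simp add: entropy_def)
qed

lemma entropy_ge:
  assumes "enat n \<le> covering_number \<epsilon> F" "0 < n"
  shows "ereal (log 2 (real n)) \<le> entropy \<epsilon> F"
  using assms by (cases "covering_number \<epsilon> F") (auto simp: entropy_def)

lemma finite_card_bool_lists:
  "finite {w :: bool list. length w = n}" "card {w :: bool list. length w = n} = 2 ^ n"
  using finite_lists_length_eq[of "UNIV :: bool set" n] card_lists_length_eq[of "UNIV :: bool set" n]
  by auto

lemma entropy_le_code_length: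
  assumes "fixed_length_code F B E R" "distortion F E R \<le> ereal \<epsilon>"
  shows "entropy \<epsilon> F \<le> ereal (real B)"
proof -
  let ?W = "{w :: bool list. length w = B}"
  have "\<exists>c\<in>R ` ?W. sup_norm (\<lambda>x. f x - c x) \<le> ereal \<epsilon>" if "f \<in> F" for f
    using assms that
    by (intro bexI[of _ "R (E f)"]) (auto simp: fixed_length_code_def distortion_def SUP_le_iff)
  then have "is_cover \<epsilon> F (R ` ?W)"
    using assms(1) finite_card_bool_lists(1) by (auto simp: is_cover_def fixed_length_code_def)
  then have "covering_number \<epsilon> F \<le> enat (card (R ` ?W))"
    by (rule covering_number_le)
  also have "\<dots> \<le> enat (2 ^ B)"
    using card_image_le[OF finite_card_bool_lists(1), of R B]
    by (simp add: finite_card_bool_lists(2))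
  finally have "entropy \<epsilon> F \<le> ereal (log 2 (real (2 ^ B)))"
    by (rule entropy_le)
  then show ?thesis
    by simp
qed

lemma is_cover_fixed_length_code:
  assumes cover: "is_cover \<epsilon> F S" and "card S \<le> 2 ^ B" "F \<noteq> {}"
  obtains E R where "fixed_length_code F B E R" "distortion F E R \<le> ereal \<epsilon>"
    "\<And>w. length w = B \<Longrightarrow> R w \<in> S"
proof -
  let ?W = "{w :: bool list. length w = B}"
  have "finite S" "S \<noteq> {}"
    using assms by (auto simp: is_cover_def)
  then have "\<exists>f. inj_on f S \<and> f ` S \<subseteq> ?W"
    using \<open>card S \<le> 2 ^ B\<close> by (subst inj_on_iff_card_le) (simp_all add: finite_card_bool_lists)
  then obtain R where R: "R ` ?W = S"
    unfolding inj_on_iff_surj[OF \<open>S \<noteq> {}\<close>] ..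
  have "\<forall>f\<in>F. \<exists>w\<in>?W. sup_norm (\<lambda>x. f x - R w x) \<le> ereal \<epsilon>"
    using cover unfolding is_cover_def R[symmetric] by blast
  then obtain E where E: "\<And>f. f \<in> F \<Longrightarrow> E f \<in> ?W \<and> sup_norm (\<lambda>x. f x - R (E f) x) \<le> ereal \<epsilon>"
    by metis
  show thesis
  proof (rule that)
    show "fixed_length_code F B E R"
      using E R cover by (auto simp: fixed_length_code_def is_cover_def)
    show "distortion F E R \<le> ereal \<epsilon>"
      unfolding distortion_def using E by (intro SUP_least) auto
  qed (use R in auto)
qed

subsection \<open>Entropy of the class of limit functions\<close>

lemma sum_arith_progression:
  fixes c l :: real
  shows "(\<Sum>k<n. c - real k * l) = real n * c - l * real n * (real n - 1) / 2"
  by (induction n) (auto simp: field_simps)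

lemma sum_arith_progression_square:
  fixes c l :: real
  assumes "l \<noteq> 0"
  shows "(\<Sum>k<n. c - real k * l) = c\<^sup>2 / (2 * l) + l / 2 * (real n - (real n - c / l)\<^sup>2)"
  unfolding sum_arith_progression using assms by (simp add: field_simps power2_eq_square)

lemma log_power_over:
  assumes "0 < a" "0 < \<epsilon>"
  shows "log 2 (a ^ k / \<epsilon>) = log 2 (1/\<epsilon>) - real k * log 2 (1/a)"
  using assms by (simp add: log_divide log_nat_power)

lemma covering_number_phi_ge_prod:
  assumes "0 < a" "0 < \<epsilon>" and fits: "\<And>k. k \<in> {1..n} \<Longrightarrow> real (m k) * (4 * \<epsilon>) \<le> a ^ (k - 1)"
  shows "enat (\<Prod>k=1..n. m k + 1) \<le> covering_number \<epsilon> (phi a ` unit_seqs)"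
proof -
  define I where "I = (\<Pi>\<^sub>E k\<in>{1..n}. {..m k})"
  define grid where "grid i k = (if k \<in> {1..n} then real (i k) * (4 * \<epsilon> / a ^ (k - 1)) else 0)"
    for i :: "nat \<Rightarrow> nat" and k
  have "real (i k) * (4 * \<epsilon> / a ^ (k - 1)) \<le> 1" if "i \<in> I" "k \<in> {1..n}" for i k
  proof -
    have "real (i k) * (4 * \<epsilon>) \<le> real (m k) * (4 * \<epsilon>)"
      using that \<open>0 < \<epsilon>\<close> by (intro mult_right_mono) (auto simp: I_def PiE_iff)
    then show ?thesis
      using fits[OF that(2)] \<open>0 < a\<close> by (simp add: divide_le_eq)
  qed
  then have grid_unit: "grid i \<in> unit_seqs" if "i \<in> I" for i
    using assms(1,2) that by (auto simp: unit_seqs_def grid_def)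
  have "enat (card I) \<le> covering_number \<epsilon> (phi a ` unit_seqs)"
  proof (rule covering_number_ge_packing[where f = "\<lambda>i. phi a (grid i)"])
    fix i j
    assume ij: "i \<in> I" "j \<in> I"
      and close: "sup_norm (\<lambda>x. phi a (grid i) x - phi a (grid j) x) \<le> ereal (2 * \<epsilon>)"
    have "i k = j k" if k: "k \<in> {1..n}" for k
    proof -
      have "a ^ (k - 1) * \<bar>grid i k - grid j k\<bar> \<le> 2 * \<epsilon>"
        using close k \<open>0 < a\<close> by (auto simp: sup_norm_phi_diff_le_iff)
      moreover have "grid i k - grid j k = (real (i k) - real (j k)) * (4 * \<epsilon> / a ^ (k - 1))"
        using k by (simp add: grid_def left_diff_distrib diff_divide_distrib)
      ultimately have "4 * \<epsilon> * \<bar>real (i k) - real (j k)\<bar> \<le> 4 * \<epsilon> * (1 / 2)"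
        using assms(1,2) by (simp add: abs_mult mult_ac)
      then have "\<bar>real (i k) - real (j k)\<bar> \<le> 1 / 2"
        using \<open>0 < \<epsilon>\<close> by (subst (asm) mult_le_cancel_left_pos) auto
      then show "i k = j k"
        by linarith
    qed
    then show "i = j"
      using ij unfolding I_def by (rule PiE_ext[rotated 2])
  qed (use grid_unit in auto)
  then show ?thesis
    by (simp add: I_def card_PiE)
qed

lemma entropy_phi_ge_sum:
  assumes "0 < a" "0 < \<epsilon>"
  shows "ereal (\<Sum>k<n. log 2 (a ^ k / (4 * \<epsilon>))) \<le> entropy \<epsilon> (phi a ` unit_seqs)"
proof -
  define m where "m k = nat \<lfloor>a ^ (k - 1) / (4 * \<epsilon>)\<rfloor>" for k
  have m: "real (m k) \<le> a ^ (k - 1) / (4 * \<epsilon>)" "a ^ (k - 1) / (4 * \<epsilon>) \<le> real (m k + 1)" for k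
    using assms by (auto simp: m_def le_nat_floor) linarith+
  have "real (m k) * (4 * \<epsilon>) \<le> a ^ (k - 1)" for k
    using m(1)[of k] assms by (simp add: le_divide_eq)
  then have covering: "enat (\<Prod>k=1..n. m k + 1) \<le> covering_number \<epsilon> (phi a ` unit_seqs)"
    using assms by (intro covering_number_phi_ge_prod)
  have "(\<Sum>k<n. log 2 (a ^ k / (4 * \<epsilon>))) = (\<Sum>k=1..n. log 2 (a ^ (k - 1) / (4 * \<epsilon>)))"
    by (simp add: sum.atLeast1_atMost_eq)
  also have "\<dots> \<le> (\<Sum>k=1..n. log 2 (real (m k + 1)))"
    using assms m(2) by (intro sum_mono) (auto simp del: of_nat_add)
  also have "\<dots> = log 2 (real (\<Prod>k=1..n. m k + 1))"
    unfolding of_nat_prod log_def by (subst ln_prod) (auto simp: sum_divide_distrib)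
  finally have "ereal (\<Sum>k<n. log 2 (a ^ k / (4 * \<epsilon>))) \<le> ereal (log 2 (real (\<Prod>k=1..n. m k + 1)))"
    by simp
  also have "\<dots> \<le> entropy \<epsilon> (phi a ` unit_seqs)"
    by (rule entropy_ge[OF covering]) (auto intro: prod_pos)
  finally show ?thesis .
qed

lemma sum_packing_bits_ge:
  fixes L l :: real
  assumes "2 \<le> L" "0 < l"
  shows "L\<^sup>2 / (2 * l) - (2 / l + l / 2) * L \<le> (\<Sum>k<nat \<lfloor>(L - 2) / l\<rfloor>. L - 2 - real k * l)"
proof -
  define n where "n = nat \<lfloor>(L - 2) / l\<rfloor>"
  have "0 \<le> (L - 2) / l"
    using assms by simp
  then have "\<bar>real n - (L - 2) / l\<bar> \<le> 1"
    unfolding n_def by linarith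
  then have "(real n - (L - 2) / l)\<^sup>2 \<le> 1"
    by (simp add: abs_square_le_1)
  then have "l / 2 * (- 1) \<le> l / 2 * (real n - (real n - (L - 2) / l)\<^sup>2)"
    using assms by (intro mult_left_mono) auto
  moreover have "L\<^sup>2 / (2 * l) - 2 / l * L \<le> (L - 2)\<^sup>2 / (2 * l)"
    using assms by (simp add: field_simps power2_eq_square)
  moreover have "l / 2 * 1 \<le> l / 2 * L"
    using assms by (intro mult_left_mono) auto
  moreover have "(2 / l + l / 2) * L = 2 / l * L + l / 2 * L"
    by (rule distrib_right)
  ultimately have "L\<^sup>2 / (2 * l) - (2 / l + l / 2) * L \<le>
      (L - 2)\<^sup>2 / (2 * l) + l / 2 * (real n - (real n - (L - 2) / l)\<^sup>2)"
    by linarith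
  also have "\<dots> = (\<Sum>k<n. L - 2 - real k * l)"
    using assms by (simp add: sum_arith_progression_square)
  finally show ?thesis
    unfolding n_def .
qed

lemma entropy_phi_ge:
  assumes "0 < a" "a < 1" "0 < \<epsilon>" "2 \<le> log 2 (1/\<epsilon>)"
  defines "L \<equiv> log 2 (1/\<epsilon>)" and "l \<equiv> log 2 (1/a)"
  shows "ereal (L\<^sup>2 / (2 * l) - (2 / l + l / 2) * L) \<le> entropy \<epsilon> (phi a ` unit_seqs)"
proof -
  let ?n = "nat \<lfloor>(L - 2) / l\<rfloor>"
  have "0 < l" "2 \<le> L"
    using assms by simp_all
  then have "L\<^sup>2 / (2 * l) - (2 / l + l / 2) * L \<le> (\<Sum>k<?n. L - 2 - real k * l)"
    by (intro sum_packing_bits_ge)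
  also have "\<dots> = (\<Sum>k<?n. log 2 (a ^ k / (4 * \<epsilon>)))"
  proof (rule sum.cong)
    fix k
    have "log 2 (a ^ k / (4 * \<epsilon>)) = log 2 (1 / (4 * \<epsilon>)) - real k * l"
      unfolding l_def using \<open>0 < a\<close> \<open>0 < \<epsilon>\<close> by (intro log_power_over) auto
    also have "log 2 (1 / (4 * \<epsilon>)) = L - 2"
      using \<open>0 < \<epsilon>\<close> log_nat_power[of 2 2 2] by (simp add: L_def log_divide log_mult)
    finally show "L - 2 - real k * l = log 2 (a ^ k / (4 * \<epsilon>))" ..
  qed simp
  finally have "ereal (L\<^sup>2 / (2 * l) - (2 / l + l / 2) * L) \<le>
      ereal (\<Sum>k<?n. log 2 (a ^ k / (4 * \<epsilon>)))"
    by simp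
  also have "\<dots> \<le> entropy \<epsilon> (phi a ` unit_seqs)"
    using \<open>0 < a\<close> \<open>0 < \<epsilon>\<close> by (rule entropy_phi_ge_sum)
  finally show ?thesis .
qed

definition dyadic_seqs :: "nat \<Rightarrow> (nat \<Rightarrow> real) set" where
  "dyadic_seqs n = {u \<in> unit_seqs. (\<forall>k\<ge>1. u k \<in> dyadics) \<and> (\<forall>k>n. u k = 0)}"

lemma dyadic_approximation:
  fixes x :: real
  assumes "0 \<le> x" "x \<le> 1"
  shows "\<exists>i<2 ^ b. \<bar>x - real i / 2 ^ b\<bar> \<le> 1 / 2 ^ b"
proof (intro exI conjI)
  define i where "i = nat (\<lceil>x * 2 ^ b\<rceil> - 1)"
  have bounds: "0 \<le> x * 2 ^ b" "x * 2 ^ b \<le> 2 ^ b" "0 < (2::real) ^ b"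
    using assms by auto
  have "real i = 0 \<or> real i < x * 2 ^ b"
    unfolding i_def by linarith
  then have "real i < 2 ^ b"
    using bounds by linarith
  then show "i < 2 ^ b"
    by (simp add: of_nat_less_numeral_power_cancel_iff)
  have "\<bar>x * 2 ^ b - real i\<bar> \<le> 1"
    unfolding i_def using bounds by linarith
  moreover have "x - real i / 2 ^ b = (x * 2 ^ b - real i) / 2 ^ b"
    by (simp add: diff_divide_distrib)
  ultimately show "\<bar>x - real i / 2 ^ b\<bar> \<le> 1 / 2 ^ b"
    by (simp add: divide_right_mono)
qed

definition dyadic_grid :: "(nat \<Rightarrow> nat) \<Rightarrow> nat \<Rightarrow> (nat \<Rightarrow> real) set" where
  "dyadic_grid b n = (\<lambda>i k. if k \<in> {1..n} then real (i k) / 2 ^ b k else 0) `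
     (\<Pi>\<^sub>E k\<in>{1..n}. {..<2 ^ b k :: nat})"

lemma finite_dyadic_grid: "finite (dyadic_grid b n)"
  unfolding dyadic_grid_def by (intro finite_imageI finite_PiE) auto

lemma card_dyadic_grid_le: "card (dyadic_grid b n) \<le> 2 ^ (\<Sum>k=1..n. b k)"
proof -
  have "card (dyadic_grid b n) \<le> card (\<Pi>\<^sub>E k\<in>{1..n}. {..<2 ^ b k :: nat})"
    unfolding dyadic_grid_def by (intro card_image_le finite_PiE) auto
  then show ?thesis
    by (simp add: card_PiE power_sum)
qed

lemma dyadic_grid_subset_dyadic_seqs: "dyadic_grid b n \<subseteq> dyadic_seqs n"
proof
  fix u
  assume "u \<in> dyadic_grid b n"
  then obtain i where i: "i \<in> (\<Pi>\<^sub>E k\<in>{1..n}. {..<2 ^ b k})"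
    and u: "\<And>k. u k = (if k \<in> {1..n} then real (i k) / 2 ^ b k else 0)"
    unfolding dyadic_grid_def by blast
  have "u k \<in> dyadics" for k
    using real_in_dyadics[of 0] by (auto simp: u dyadics_def)
  moreover have "real (i k) \<le> 2 ^ b k" if "k \<in> {1..n}" for k
    using i that by (force simp: PiE_iff)
  then have "u \<in> unit_seqs"
    by (auto simp: unit_seqs_def u)
  moreover have "u k = 0" if "k > n" for k
    using that by (simp add: u)
  ultimately show "u \<in> dyadic_seqs n"
    by (simp add: dyadic_seqs_def)
qed

lemma dyadic_grid_approximation:
  assumes "t \<in> unit_seqs" and support: "\<And>k. k > n \<Longrightarrow> b k = 0"
  obtains u where "u \<in> dyadic_grid b n" "\<And>k. k \<ge> 1 \<Longrightarrow> \<bar>t k - u k\<bar> \<le> 1 / 2 ^ b k"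
proof -
  have "\<forall>k\<ge>1. \<exists>i<2 ^ b k. \<bar>t k - real i / 2 ^ b k\<bar> \<le> 1 / 2 ^ b k"
    using assms by (auto simp: unit_seqs_def intro!: dyadic_approximation)
  then obtain i where i: "\<And>k. k \<ge> 1 \<Longrightarrow> i k < 2 ^ b k"
    "\<And>k. k \<ge> 1 \<Longrightarrow> \<bar>t k - real (i k) / 2 ^ b k\<bar> \<le> 1 / 2 ^ b k"
    by metis
  define u where "u k = (if k \<in> {1..n} then real (restrict i {1..n} k) / 2 ^ b k else 0)" for k
  have "restrict i {1..n} \<in> (\<Pi>\<^sub>E k\<in>{1..n}. {..<2 ^ b k})"
    using i(1) by auto
  then have "u \<in> dyadic_grid b n"
    unfolding dyadic_grid_def u_def[abs_def] by blast
  moreover have "u k = real (i k) / 2 ^ b k" if "k \<ge> 1" for k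
    \<comment> \<open>beyond \<open>n\<close> there are no bits left, so \<open>i k = 0\<close>\<close>
    using that i(1)[of k] support[of k] by (auto simp: u_def)
  ultimately show thesis
    using that i(2) by simp
qed

lemma is_cover_dyadic_grid:
  assumes "0 < a" "a \<le> 1" and resolution: "\<And>k. a ^ (k - 1) \<le> 2 ^ b k * \<epsilon>"
    and support: "\<And>k. k > n \<Longrightarrow> b k = 0"
  shows "is_cover \<epsilon> (phi a ` unit_seqs) (phi a ` dyadic_grid b n)"
proof -
  have "\<exists>u\<in>dyadic_grid b n. sup_norm (\<lambda>x. phi a t x - phi a u x) \<le> ereal \<epsilon>" if "t \<in> unit_seqs" for t
  proof -
    obtain u where u: "u \<in> dyadic_grid b n" "\<And>k. k \<ge> 1 \<Longrightarrow> \<bar>t k - u k\<bar> \<le> 1 / 2 ^ b k"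
      using dyadic_grid_approximation[of t n b] \<open>t \<in> unit_seqs\<close> support by blast
    have "a ^ (k - 1) * \<bar>t k - u k\<bar> \<le> \<epsilon>" if "k \<ge> 1" for k
    proof -
      have "a ^ (k - 1) * \<bar>t k - u k\<bar> \<le> a ^ (k - 1) * (1 / 2 ^ b k)"
        using u(2)[OF that] \<open>0 < a\<close> by (intro mult_left_mono) auto
      also have "\<dots> \<le> \<epsilon>"
        using resolution[of k] by (simp add: divide_le_eq mult.commute)
      finally show ?thesis .
    qed
    then show ?thesis
      using u(1) \<open>0 < a\<close> by (auto simp: sup_norm_phi_diff_le_iff)
  qed
  moreover have "dyadic_grid b n \<subseteq> unit_seqs"
    using dyadic_grid_subset_dyadic_seqs[of b n] by (auto simp: dyadic_seqs_def)
  ultimately show ?thesis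
    using assms(1,2) finite_dyadic_grid by (auto simp: is_cover_def intro!: bounded_range_phi)
qed

lemma power_le_two_power_ceiling:
  assumes "0 < a" "0 < \<epsilon>"
  shows "a ^ k \<le> 2 ^ nat \<lceil>log 2 (1/\<epsilon>) - real k * log 2 (1/a)\<rceil> * \<epsilon>"
proof -
  define b where "b = nat \<lceil>log 2 (1/\<epsilon>) - real k * log 2 (1/a)\<rceil>"
  have "log 2 (a ^ k / \<epsilon>) \<le> real b"
    unfolding log_power_over[OF assms] b_def by linarith
  then have "a ^ k / \<epsilon> \<le> 2 ^ b"
    using assms by (simp add: log_le_iff powr_realpow)
  then show ?thesis
    using assms by (simp add: divide_le_eq b_def)
qed

lemma sum_bit_allocation_le:
  fixes L l :: real
  assumes "1 \<le> L" "0 < l"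
  shows "(\<Sum>k<nat \<lceil>L / l\<rceil>. real (nat \<lceil>L - real k * l\<rceil>)) \<le>
    L\<^sup>2 / (2 * l) + (3 / (2 * l) + (1 + l) / 2) * L"
proof -
  let ?n = "nat \<lceil>L / l\<rceil>"
  have "0 < L / l"
    using assms by simp
  then have n: "real ?n \<le> L / l + 1"
    by linarith
  have "(\<Sum>k<?n. real (nat \<lceil>L - real k * l\<rceil>)) \<le> (\<Sum>k<?n. (L + 1) - real k * l)"
  proof (rule sum_mono)
    fix k
    assume "k \<in> {..<?n}"
    then have "real k \<le> L / l"
      using n by auto
    then have "real k * l \<le> L"
      using assms by (simp add: le_divide_eq)
    then show "real (nat \<lceil>L - real k * l\<rceil>) \<le> (L + 1) - real k * l"
      by linarith
  qed
  also have "\<dots> \<le> (L + 1)\<^sup>2 / (2 * l) + l / 2 * (L / l + 1)"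
    unfolding sum_arith_progression_square[OF less_imp_neq[OF assms(2), symmetric]]
    using n assms by (intro add_left_mono mult_left_mono order_trans[OF _ n]) auto
  also have "\<dots> = L\<^sup>2 / (2 * l) + (1 / l + 1 / 2) * L + (1 / (2 * l) + l / 2) * 1"
    using assms by (simp add: field_simps power2_eq_square)
  also have "\<dots> \<le> L\<^sup>2 / (2 * l) + (1 / l + 1 / 2) * L + (1 / (2 * l) + l / 2) * L"
    using assms by (intro add_left_mono mult_left_mono) auto
  also have "\<dots> = L\<^sup>2 / (2 * l) + (3 / (2 * l) + (1 + l) / 2) * L"
    using assms by (simp add: field_simps)
  finally show ?thesis .
qed

lemma fixed_length_code_dyadic:
  assumes "0 < a" "a < 1" "0 < \<epsilon>" "1 \<le> log 2 (1/\<epsilon>)"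
  defines "L \<equiv> log 2 (1/\<epsilon>)" and "l \<equiv> log 2 (1/a)"
  obtains B E R where "fixed_length_code (phi a ` unit_seqs) B E R"
    "distortion (phi a ` unit_seqs) E R \<le> ereal \<epsilon>"
    "real B \<le> L\<^sup>2 / (2 * l) + (3 / (2 * l) + (1 + l) / 2) * L"
    "\<And>w. length w = B \<Longrightarrow> R w \<in> phi a ` dyadic_seqs (nat \<lceil>L / l\<rceil>)"
proof -
  have l: "0 < l" and L: "1 \<le> L"
    using assms by simp_all
  define n where "n = nat \<lceil>L / l\<rceil>"
  define b where "b k = nat \<lceil>L - real (k - 1) * l\<rceil>" for k
  have support: "b k = 0" if "k > n" for k
  proof -
    have "L / l \<le> real (k - 1)"
      using that unfolding n_def by linarith
    then show ?thesis
      using l by (simp add: b_def divide_le_eq)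
  qed
  have "a ^ (k - 1) \<le> 2 ^ b k * \<epsilon>" for k
    unfolding b_def L_def l_def using assms(1,3) by (rule power_le_two_power_ceiling)
  then have cover: "is_cover \<epsilon> (phi a ` unit_seqs) (phi a ` dyadic_grid b n)"
    using assms(1,2) support by (intro is_cover_dyadic_grid) auto
  have "(\<lambda>_. 0) \<in> unit_seqs"
    by (simp add: unit_seqs_def)
  then have "phi a ` unit_seqs \<noteq> {}"
    by blast
  moreover have "card (phi a ` dyadic_grid b n) \<le> 2 ^ (\<Sum>k=1..n. b k)"
    using card_image_le[OF finite_dyadic_grid] card_dyadic_grid_le by (rule order_trans)
  ultimately obtain E R where code: "fixed_length_code (phi a ` unit_seqs) (\<Sum>k=1..n. b k) E R"
    "distortion (phi a ` unit_seqs) E R \<le> ereal \<epsilon>"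
    and R: "\<And>w. length w = (\<Sum>k=1..n. b k) \<Longrightarrow> R w \<in> phi a ` dyadic_grid b n"
    using is_cover_fixed_length_code[OF cover] by metis
  have "real (\<Sum>k=1..n. b k) = (\<Sum>k<n. real (nat \<lceil>L - real k * l\<rceil>))"
    by (simp add: sum.atLeast1_atMost_eq b_def)
  also have "\<dots> \<le> L\<^sup>2 / (2 * l) + (3 / (2 * l) + (1 + l) / 2) * L"
    unfolding n_def by (rule sum_bit_allocation_le[OF L l])
  finally show thesis
    using that[OF code] R dyadic_grid_subset_dyadic_seqs unfolding n_def by blast
qed

lemma entropy_phi_le:
  assumes "0 < a" "a < 1" "0 < \<epsilon>" "1 \<le> log 2 (1/\<epsilon>)"
  defines "L \<equiv> log 2 (1/\<epsilon>)" and "l \<equiv> log 2 (1/a)"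
  shows "entropy \<epsilon> (phi a ` unit_seqs) \<le> ereal (L\<^sup>2 / (2 * l) + (3 / (2 * l) + (1 + l) / 2) * L)"
proof -
  obtain B E R where "fixed_length_code (phi a ` unit_seqs) B E R"
    "distortion (phi a ` unit_seqs) E R \<le> ereal \<epsilon>"
    and B: "real B \<le> L\<^sup>2 / (2 * l) + (3 / (2 * l) + (1 + l) / 2) * L"
    using fixed_length_code_dyadic[OF assms(1-4)] unfolding L_def l_def by metis
  then have "entropy \<epsilon> (phi a ` unit_seqs) \<le> ereal (real B)"
    by (intro entropy_le_code_length)
  also have "\<dots> \<le> ereal (L\<^sup>2 / (2 * l) + (3 / (2 * l) + (1 + l) / 2) * L)"
    using B by simp
  finally show ?thesis .
qed

subsection \<open>ReLU networks for finite bump sums\<close>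

lemma hat_eq_relu_sum: "hat (x - 2) = max (x - 2) 0 - 2 * max (x - 3) 0 + max (x - 4) 0"
  by (auto simp: hat_def max_def abs_if)

lemma bump_max_0: "bump k (max x 0) = bump k x"
proof (cases "x \<ge> 0")
  case False
  then have "2 ^ Suc k * x \<le> 0"
    by (intro mult_nonneg_nonpos) auto
  then show ?thesis
    using False by (simp add: bump_def hat_eq_0 del: power_Suc)
qed simp

definition first_layer :: affine where
  "first_layer = ([[2], [2], [2], [2], [0]], [0, -2, -3, -4, 0])"

definition step_layer :: "real \<Rightarrow> affine" where
  "step_layer c =
    ([[2, 0, 0, 0, 0], [2, 0, 0, 0, 0], [2, 0, 0, 0, 0], [2, 0, 0, 0, 0], [0, c, -2 * c, c, 1]],
     [0, -2, -3, -4, 0])"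

definition out_layer :: "real \<Rightarrow> affine" where
  "out_layer c = ([[0, c, -2 * c, c, 1]], [0])"

definition bump_net :: "(nat \<Rightarrow> real) \<Rightarrow> nat \<Rightarrow> network" where
  "bump_net c n = (first_layer # map (\<lambda>k. step_layer (c k)) [0..<n], out_layer (c n))"

text \<open>The output of the last hidden layer. Its entries two to four are ramps that combine to
  \<open>bump n x\<close>; the partial sum is nonnegative for nonnegative coefficients and hence unaffected by
  the activation.\<close>

definition bump_net_state :: "(nat \<Rightarrow> real) \<Rightarrow> nat \<Rightarrow> real \<Rightarrow> real list" where
  "bump_net_state c n x = (let z = 2 ^ Suc n * max x 0 in
     [z, max (z - 2) 0, max (z - 3) 0, max (z - 4) 0, \<Sum>k<n. c k * bump k x])"

lemma bump_eq_relu_sum: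
  assumes "z = 2 ^ Suc k * max x 0"
  shows "bump k x = max (z - 2) 0 - 2 * max (z - 3) 0 + max (z - 4) 0"
  using bump_max_0[of k x] unfolding bump_def assms hat_eq_relu_sum by simp

lemma affine_apply_step_layer:
  "affine_apply (step_layer b) (bump_net_state c n x) =
    (let z = 2 ^ Suc (Suc n) * max x 0 in
     [z, z - 2, z - 3, z - 4, (\<Sum>k<n. c k * bump k x) + b * bump n x])"
  by (simp add: Let_def bump_net_state_def step_layer_def affine_apply_def bump_eq_relu_sum[OF refl]
      algebra_simps)

lemma affine_apply_out_layer:
  "affine_apply (out_layer b) (bump_net_state c n x) = [(\<Sum>k<n. c k * bump k x) + b * bump n x]"
  by (simp add: Let_def bump_net_state_def out_layer_def affine_apply_def bump_eq_relu_sum[OF refl]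
      algebra_simps)

lemma fold_bump_net:
  assumes "\<And>k. 0 \<le> c k"
  shows "fold (\<lambda>H v. map (\<lambda>y. max y 0) (affine_apply H v)) (fst (bump_net c n)) [x] =
    bump_net_state c n x"
proof (induction n)
  case 0
  show ?case
    by (auto simp: bump_net_def bump_net_state_def first_layer_def affine_apply_def Let_def max_def)
next
  case (Suc n)
  have "0 \<le> (\<Sum>k<n. c k * bump k x) + c n * bump n x"
    using assms bump_nonneg by (intro add_nonneg_nonneg sum_nonneg mult_nonneg_nonneg) auto
  then have "map (\<lambda>y. max y 0) (affine_apply (step_layer (c n)) (bump_net_state c n x)) =
      bump_net_state c (Suc n) x"
    unfolding affine_apply_step_layer by (simp add: bump_net_state_def Let_def)
  then show ?case
    using Suc by (simp add: bump_net_def)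
qed

lemma hidden_ok_uniform:
  assumes "\<And>H. H \<in> set Hs \<Longrightarrow> affine_ok d H \<and> out_dim H = d" "affine_ok d L" "out_dim L = e"
  shows "hidden_ok d Hs L e"
  using assms by (induction Hs) auto

lemma computes_bump_net:
  assumes "\<And>k. 0 \<le> c k" "\<And>k. k > n \<Longrightarrow> c k = 0"
  shows "computes (bump_net c n) (bump_series c)"
proof -
  have "network_ok 1 1 (bump_net c n)"
    by (auto simp: network_ok_def bump_net_def first_layer_def step_layer_def out_layer_def
        affine_ok_def out_dim_def intro!: hidden_ok_uniform)
  moreover have "network_eval (bump_net c n) [x] = [bump_series c x]" for x
  proof -
    have "network_eval (bump_net c n) [x] = affine_apply (out_layer (c n)) (bump_net_state c n x)"
      using fold_bump_net[of c n x, OF assms(1)] by (simp add: network_eval_def bump_net_def)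
    also have "\<dots> = [\<Sum>k<Suc n. c k * bump k x]"
      by (simp add: affine_apply_out_layer)
    also have "(\<Sum>k<Suc n. c k * bump k x) = bump_series c x"
      using assms(2) by (intro bump_series_eq_sum[symmetric]) auto
    finally show ?thesis .
  qed
  ultimately show ?thesis
    by (simp add: computes_def)
qed

lemma network_depth_bump_net: "network_depth (bump_net c n) = n + 1"
  by (simp add: network_depth_def bump_net_def)

lemma network_width_bump_net: "network_width (bump_net c n) \<le> 5"
  unfolding network_width_def
  by (rule Max.boundedI) (auto simp: bump_net_def first_layer_def step_layer_def out_dim_def)

lemma length_network_params_bump_net: "length (network_params (bump_net c n)) = 30 * n + 16"
  by (simp add: network_params_def bump_net_def length_concat comp_def affine_entries_def
      first_layer_def step_layer_def out_layer_def sum_list_triv)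

lemma network_params_bump_net_rational:
  assumes "\<And>k. c k \<in> \<rat>"
  shows "set (network_params (bump_net c n)) \<subseteq> \<rat>"
  using assms
  by (auto simp: network_params_def bump_net_def affine_entries_def
      first_layer_def step_layer_def out_layer_def)

lemma dyadics_subset_Rats: "(dyadics :: real set) \<subseteq> \<rat>"
  by (auto simp: dyadics_def)

lemma finite_support_dyadic_seqs:
  assumes "u \<in> dyadic_seqs n"
  shows "finite {k. k \<ge> 1 \<and> u k \<noteq> 0}"
proof (rule finite_subset)
  show "{k. k \<ge> 1 \<and> u k \<noteq> 0} \<subseteq> {..n}"
    using assms by (auto simp: dyadic_seqs_def not_less[symmetric])
qed simp

lemma phi_dyadic_seqs_realisation:
  assumes "0 \<le> a" "a \<in> \<rat>" "f \<in> phi a ` dyadic_seqs n" and size: "30 * real n + 16 \<le> S"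
  shows "(\<exists>u\<in>unit_seqs. finite {k. k \<ge> 1 \<and> u k \<noteq> 0} \<and> (\<forall>k\<ge>1. u k \<in> dyadics) \<and> f = phi a u) \<and>
    (\<exists>N. computes N f \<and> set (network_params N) \<subseteq> \<rat> \<and> network_width N \<le> 5 \<and>
      real (network_depth N) \<le> S \<and> real (length (network_params N)) \<le> S)"
proof -
  obtain u where u: "u \<in> dyadic_seqs n" and f: "f = phi a u"
    using assms(3) by blast
  define c where "c k = a ^ k * u (Suc k)" for k
  have bounds: "u (Suc k) \<in> {0..1}" "u (Suc k) \<in> \<rat>" "k \<ge> n \<Longrightarrow> u (Suc k) = 0" for k
    using u dyadics_subset_Rats by (auto simp: dyadic_seqs_def unit_seqs_def)
  have "computes (bump_net c n) f"
    unfolding f phi_eq_bump_series c_def[symmetric]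
    using assms bounds by (intro computes_bump_net) (auto simp: c_def)
  moreover have "set (network_params (bump_net c n)) \<subseteq> \<rat>"
    using assms bounds by (intro network_params_bump_net_rational) (auto simp: c_def)
  moreover have "real (network_depth (bump_net c n)) \<le> S"
    "real (length (network_params (bump_net c n))) \<le> S"
    using size by (simp_all add: network_depth_bump_net length_network_params_bump_net)
  ultimately show ?thesis
    using u f finite_support_dyadic_seqs[OF u] network_width_bump_net[of c n]
    by (intro conjI bexI[of _ u] exI[of _ "bump_net c n"]) (simp_all add: dyadic_seqs_def)
qed

subsection \<open>Asymptotics for small distortion\<close>

lemma eventually_log_inverse_ge: "\<forall>\<^sub>F \<epsilon> in at_right (0::real). 0 < \<epsilon> \<and> M \<le> log 2 (1/\<epsilon>)"
proof -
  have "M \<le> log 2 (1/\<epsilon>)" if "0 < \<epsilon>" "\<epsilon> < 2 powr (- M)" for \<epsilon> :: real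
  proof -
    have "log 2 \<epsilon> < - M"
      using that by (simp add: log_less_iff)
    then show ?thesis
      using that by (simp add: log_divide)
  qed
  then show ?thesis
    unfolding eventually_at_right_field by (intro exI[of _ "2 powr (- M)"]) auto
qed

lemma abs_ereal_diff_le:
  assumes "ereal (y - r) \<le> x" "x \<le> ereal (y + s)" "r \<le> d" "s \<le> d"
  shows "\<bar>x - ereal y\<bar> \<le> ereal d"
  using assms by (cases x) auto

lemma entropy_phi_log_squared:
  assumes "0 < a" "a < 1"
  shows "\<exists>K. \<forall>\<^sub>F \<epsilon> in at_right 0.
    \<bar>entropy \<epsilon> (phi a ` unit_seqs) - ereal ((log 2 (1/\<epsilon>))\<^sup>2 / (2 * log 2 (1/a)))\<bar>
      \<le> ereal (K * log 2 (1/\<epsilon>))"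
proof -
  define l where "l = log 2 (1/a)"
  define lower_const where "lower_const = 2 / l + l / 2"
  define upper_const where "upper_const = 3 / (2 * l) + (1 + l) / 2"
  show ?thesis
  proof (intro exI[of _ "max lower_const upper_const"]
      eventually_mono[OF eventually_log_inverse_ge[of 2]])
    fix \<epsilon> :: real
    assume \<epsilon>: "0 < \<epsilon> \<and> 2 \<le> log 2 (1/\<epsilon>)"
    show "\<bar>entropy \<epsilon> (phi a ` unit_seqs) - ereal ((log 2 (1/\<epsilon>))\<^sup>2 / (2 * log 2 (1/a)))\<bar>
        \<le> ereal (max lower_const upper_const * log 2 (1/\<epsilon>))"
    proof (rule abs_ereal_diff_le)
      show "ereal ((log 2 (1/\<epsilon>))\<^sup>2 / (2 * log 2 (1/a)) - lower_const * log 2 (1/\<epsilon>))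
          \<le> entropy \<epsilon> (phi a ` unit_seqs)"
        unfolding lower_const_def l_def using assms \<epsilon> by (intro entropy_phi_ge) auto
      show "entropy \<epsilon> (phi a ` unit_seqs)
          \<le> ereal ((log 2 (1/\<epsilon>))\<^sup>2 / (2 * log 2 (1/a)) + upper_const * log 2 (1/\<epsilon>))"
        unfolding upper_const_def l_def using assms \<epsilon> by (intro entropy_phi_le) linarith+
    qed (use \<epsilon> in \<open>intro mult_right_mono; linarith\<close>)+
  qed
qed

lemma code_length_gt_log_squared:
  assumes "0 < a" "a < 1" "c < 1 / (2 * log 2 (1/a))"
  shows "\<forall>\<^sub>F \<epsilon> in at_right 0. \<forall>B E R.
    fixed_length_code (phi a ` unit_seqs) B E R \<and> distortion (phi a ` unit_seqs) E R \<le> ereal \<epsilon> \<longrightarrow>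
      real B > c * (log 2 (1/\<epsilon>))\<^sup>2"
proof -
  define l where "l = log 2 (1/a)"
  define gap where "gap = 1 / (2 * l) - c"
  define K where "K = 2 / l + l / 2"
  have "0 < gap"
    using assms by (simp add: gap_def l_def)
  show ?thesis
  proof (rule eventually_mono[OF eventually_log_inverse_ge[of "max 2 (K / gap + 1)"]],
      intro allI impI)
    fix \<epsilon> :: real and B E R
    assume \<epsilon>: "0 < \<epsilon> \<and> max 2 (K / gap + 1) \<le> log 2 (1/\<epsilon>)"
      and code: "fixed_length_code (phi a ` unit_seqs) B E R \<and>
        distortion (phi a ` unit_seqs) E R \<le> ereal \<epsilon>"
    define L where "L = log 2 (1/\<epsilon>)"
    have L: "2 \<le> L" "K / gap < L"
      using \<epsilon> by (auto simp: L_def)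
    have "ereal (L\<^sup>2 / (2 * l) - K * L) \<le> entropy \<epsilon> (phi a ` unit_seqs)"
      using entropy_phi_ge[of a \<epsilon>] assms \<epsilon> unfolding L_def K_def l_def by auto
    also have "\<dots> \<le> ereal (real B)"
      using code by (intro entropy_le_code_length) auto
    finally have "L\<^sup>2 / (2 * l) - K * L \<le> real B"
      by simp
    moreover have "K * L < gap * L * L"
      using L \<open>0 < gap\<close> by (intro mult_strict_right_mono) (auto simp: divide_less_eq mult.commute)
    moreover have "gap * L * L = L\<^sup>2 / (2 * l) - c * L\<^sup>2"
      by (simp add: gap_def power2_eq_square left_diff_distrib)
    ultimately show "real B > c * (log 2 (1/\<epsilon>))\<^sup>2"
      unfolding L_def by linarith
  qed
qed

lemma affine_ceiling_le:
  fixes p q L l :: real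
  assumes "0 \<le> p" "0 \<le> q" "1 \<le> L" "0 < l"
  shows "p * real (nat \<lceil>L / l\<rceil>) + q \<le> (p / l + p + q) * L"
proof -
  have "0 < L / l"
    using assms by simp
  then have "real (nat \<lceil>L / l\<rceil>) \<le> L / l + 1"
    by linarith
  then have "p * real (nat \<lceil>L / l\<rceil>) \<le> p * (L / l + 1)"
    using assms by (intro mult_left_mono)
  moreover have "(p + q) * 1 \<le> (p + q) * L"
    using assms by (intro mult_left_mono) auto
  ultimately show ?thesis
    by (simp add: algebra_simps)
qed

lemma fixed_length_code_dyadic_network:
  assumes "0 < a" "a < 1" "a \<in> \<rat>"
  shows "\<exists>K. \<forall>\<^sub>F \<epsilon> in at_right 0. \<exists>B E R.
    fixed_length_code (phi a ` unit_seqs) B E R \<and>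
    distortion (phi a ` unit_seqs) E R \<le> ereal \<epsilon> \<and>
    real B \<le> (log 2 (1/\<epsilon>))\<^sup>2 / (2 * log 2 (1/a)) + K * log 2 (1/\<epsilon>) \<and>
    (\<forall>w. length w = B \<longrightarrow>
      (\<exists>u\<in>unit_seqs. finite {k. k \<ge> 1 \<and> u k \<noteq> 0} \<and> (\<forall>k\<ge>1. u k \<in> dyadics) \<and> R w = phi a u) \<and>
      (\<exists>N. computes N (R w) \<and> set (network_params N) \<subseteq> \<rat> \<and> network_width N \<le> 5 \<and>
         real (network_depth N) \<le> K * log 2 (1/\<epsilon>) \<and>
         real (length (network_params N)) \<le> K * log 2 (1/\<epsilon>)))"
proof -
  define l where "l = log 2 (1/a)"
  define bit_const where "bit_const = 3 / (2 * l) + (1 + l) / 2"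
  define K where "K = bit_const + (30 / l + 30 + 16)"
  have "0 < l"
    using assms by (simp add: l_def)
  show ?thesis
  proof (intro exI[of _ K] eventually_mono[OF eventually_log_inverse_ge[of 1]], goal_cases code)
    case \<epsilon>: (code \<epsilon>)
    define L where "L = log 2 (1/\<epsilon>)"
    define n where "n = nat \<lceil>L / l\<rceil>"
    obtain B E R where code: "fixed_length_code (phi a ` unit_seqs) B E R"
      "distortion (phi a ` unit_seqs) E R \<le> ereal \<epsilon>"
      and B: "real B \<le> L\<^sup>2 / (2 * l) + bit_const * L"
      and R: "\<And>w. length w = B \<Longrightarrow> R w \<in> phi a ` dyadic_seqs n"
      using fixed_length_code_dyadic[of a \<epsilon>] assms \<epsilon>
      unfolding L_def l_def n_def bit_const_def by metis
    have "1 \<le> L"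
      using \<epsilon> by (simp add: L_def)
    then have "30 * real n + 16 \<le> (30 / l + 30 + 16) * L"
      "0 \<le> bit_const * L" "0 \<le> (30 / l + 30 + 16) * L"
      using affine_ceiling_le[of 30 16 L l] \<open>0 < l\<close> by (simp_all add: n_def bit_const_def)
    then have K: "bit_const * L \<le> K * L" "30 * real n + 16 \<le> K * L"
      unfolding K_def distrib_right[of bit_const] by linarith+
    have "real B \<le> L\<^sup>2 / (2 * l) + K * L"
      using B K(1) by linarith
    moreover note phi_dyadic_seqs_realisation[OF less_imp_le[OF assms(1)] assms(3) R K(2)]
    ultimately show ?case
      using code unfolding L_def l_def by blast
  qed
qed

theorem theorem4p1:
  shows "\<exists>W::nat. \<forall>a::real. 1/2 < a \<and> a < 1 \<longrightarrow>
    \<comment> \<open>(i)\<close>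
    (\<forall>t\<in>unit_seqs.
      (\<forall>n\<ge>1. sup_norm (\<lambda>x. cascade (\<lambda>k. subdiv (subdiv_mask a (t k))) n gen x - Phi a t x)
                \<le> ereal (a ^ n)) \<and>
      (\<forall>U :: nat \<Rightarrow> real^3^4. (\<forall>k\<ge>1. orthonormal_kernel_basis match_map (U k)) \<longrightarrow>
        (\<forall>k\<ge>1. defect (\<lambda>_. match_map) U (\<lambda>k. subdiv_mask a (t k)) gen k = 0) \<and>
        has_chron_radius (kernel_block U (\<lambda>k. subdiv_mask a (t k))) a)) \<and>
    \<comment> \<open>(ii)\<close>
    (\<forall>t\<in>unit_seqs. \<forall>s\<in>unit_seqs.
      sup_norm (\<lambda>x. phi a t x - phi a s x) = (SUP k\<in>{1..}. ereal (a ^ (k - 1) * \<bar>t k - s k\<bar>))) \<and>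
    (\<exists>K. \<forall>\<^sub>F \<epsilon> in at_right 0.
      \<bar>entropy \<epsilon> (phi a ` unit_seqs) - ereal ((log 2 (1/\<epsilon>))\<^sup>2 / (2 * log 2 (1/a)))\<bar>
        \<le> ereal (K * log 2 (1/\<epsilon>))) \<and>
    (\<forall>\<epsilon>>0. entropy \<epsilon> (Phi a ` unit_seqs) = entropy \<epsilon> (phi a ` unit_seqs)) \<and>
    \<comment> \<open>(iii)\<close>
    (a \<in> \<rat> \<longrightarrow>
      (\<exists>K. \<forall>\<^sub>F \<epsilon> in at_right 0. \<exists>B E R.
        fixed_length_code (phi a ` unit_seqs) B E R \<and>
        distortion (phi a ` unit_seqs) E R \<le> ereal \<epsilon> \<and>
        real B \<le> (log 2 (1/\<epsilon>))\<^sup>2 / (2 * log 2 (1/a)) + K * log 2 (1/\<epsilon>) \<and>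
        (\<forall>w. length w = B \<longrightarrow>
          (\<exists>u\<in>unit_seqs. finite {k. k \<ge> 1 \<and> u k \<noteq> 0} \<and> (\<forall>k\<ge>1. u k \<in> dyadics) \<and>
             R w = phi a u) \<and>
          (\<exists>N. computes N (R w) \<and> set (network_params N) \<subseteq> \<rat> \<and> network_width N \<le> W \<and>
             real (network_depth N) \<le> K * log 2 (1/\<epsilon>) \<and>
             real (length (network_params N)) \<le> K * log 2 (1/\<epsilon>))))) \<and>
    (\<forall>c < 1 / (2 * log 2 (1/a)). \<forall>\<^sub>F \<epsilon> in at_right 0. \<forall>B E R.
      fixed_length_code (phi a ` unit_seqs) B E R \<and>
      distortion (phi a ` unit_seqs) E R \<le> ereal \<epsilon> \<longrightarrow>
        real B > c * (log 2 (1/\<epsilon>))\<^sup>2)"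
proof (rule exI[of _ 5], intro allI impI conjI ballI,
    goal_cases cascade defect radius isometry entropy vector_entropy code optimality)
  case (cascade a t n)
  then show ?case by (intro sup_norm_cascade_minus_Phi_le) auto
next
  case defect
  show ?case by (rule defect_match_map)
next
  case (radius a t U)
  then show ?case by (intro has_chron_radius_match_map) auto
next
  case (isometry a t s)
  then show ?case by (intro sup_norm_phi_diff) auto
next
  case (entropy a)
  then show ?case by (intro entropy_phi_log_squared) auto
next
  case (vector_entropy a \<epsilon>)
  then show ?case by (intro entropy_Phi_eq_entropy_phi) auto
next
  case (code a)
  then show ?case by (intro fixed_length_code_dyadic_network) auto
next
  case (optimality a c)
  then show ?case by (intro code_length_gt_log_squared) auto
qed

end
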